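(* Let $\alpha,\beta>0$, $\mu_1,\mu_2\in\mathbb{R}$, $\sigma_1,\sigma_2>0$, and let $X\sim GGD(\mu_1,\sigma_1,\alpha)$ and $Y\sim GGD(\mu_2,\sigma_2,\beta)$ be independent. Put $Z=X+Y$ and $\mu=\mu_1+\mu_2$. Then for every $z\neq\mu$ the density of $Z$ is $$f_Z(z)=\frac{\sqrt{\pi}}{\Gamma(1/\alpha)\Gamma(1/\beta)\,|z-\mu|}\;\mathcal{G}_0\!\left(\frac{\sigma_1^2\Gamma(1/\alpha)}{\Gamma(3/\alpha)(z-\mu)^2},\ \frac{\sigma_2^2\Gamma(1/\beta)}{\Gamma(3/\beta)(z-\mu)^2}\right),$$ where $\mathcal{G}_0(x,y)={\rm H}^{0,1;1,1;1,1}_{2,0;1,2;1,2}\!\left[x,y\,\middle|\,\begin{matrix}(\tfrac12;1,1),(0;1,1)\\ -\end{matrix}\,\middle|\,\begin{matrix}(1-\tfrac1\alpha,\tfrac2\alpha)\\(0,1),(\tfrac12,1)\end{matrix}\,\middle|\,\begin{matrix}(1-\tfrac1\beta,\tfrac2\beta)\\(0,1),(\tfrac12,1)\end{matrix}\right]$, i.e. $$\mathcal{G}_0(x,y)=\frac{1}{(2\pi i)^2}\int_{L_1}\int_{L_2}\frac{\Gamma(\tfrac12+s+u)}{\Gamma(-s-u)}\,\theta_\alpha(s)\,\theta_\beta(u)\,x^s y^u\,du\,ds .$$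
   Context: For $\alpha>0$, $\mu\in\mathbb{R}$, $\sigma>0$, a random variable $X\sim GGD(\mu,\sigma,\alpha)$ (generalized Gaussian) has density $f_X(x)=\frac{\alpha\Lambda}{2\Gamma(1/\alpha)}\exp(-\Lambda^\alpha|x-\mu|^\alpha)$, $x\in\mathbb{R}$, where $\Lambda=\frac{1}{\sigma}\sqrt{\Gamma(3/\alpha)/\Gamma(1/\alpha)}$. For $\alpha>0$ set $\theta_\alpha(s)=\frac{\Gamma(-s)\,\Gamma\left(\frac1\alpha+\frac{2s}{\alpha}\right)}{\Gamma\left(\frac12+s\right)}$. The bivariate Fox H-function (in the sense of Mittal and Gupta) is defined by ${\rm H}^{0,n_1;m_2,n_2;m_3,n_3}_{p_1,q_1;p_2,q_2;p_3,q_3}[x,y\mid (a_j;\alpha_j,A_j)_{1}^{p_1}:(b_j;\beta_j,B_j)_1^{q_1}\mid (c_j,\gamma_j)_1^{p_2};(d_j,\delta_j)_1^{q_2}\mid (e_j,E_j)_1^{p_3};(f_j,F_j)_1^{q_3}]=\frac{1}{(2\pi i)^2}\int_{L_1}\int_{L_2}\phi(s,u)\theta_2(s)\theta_3(u)x^sy^u\,du\,ds$, where $\phi(s,u)=\frac{\prod_{j=1}^{n_1}\Gamma(1-a_j+\alpha_js+A_ju)}{\prod_{j=n_1+1}^{p_1}\Gamma(a_j-\alpha_js-A_ju)\prod_{j=1}^{q_1}\Gamma(1-b_j+\beta_js+B_ju)}$, $\theta_2(s)=\frac{\prod_{j=1}^{m_2}\Gamma(d_j-\delta_js)\prod_{j=1}^{n_2}\Gamma(1-c_j+\gamma_js)}{\prod_{j=m_2+1}^{q_2}\Gamma(1-d_j+\delta_js)\prod_{j=n_2+1}^{p_2}\Gamma(c_j-\gamma_js)}$,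 $\theta_3$ analogously with $(e_j,E_j),(f_j,F_j),m_3,n_3$, and $L_1,L_2$ are suitable Mellin–Barnes contours in the $s$- and $u$-planes separating the increasing and decreasing sequences of poles of the gamma factors. In the notation above, the upper row of each bracket lists the "numerator-type" parameters $(a_j)$, $(c_j)$, $(e_j)$ and the lower row the parameters $(b_j)$, $(d_j)$, $(f_j)$; "$-$" denotes an empty list. *)

theory Defs
  imports "HOL-Probability.Probability"
begin

definition ggd_Lambda :: "real \<Rightarrow> real \<Rightarrow> real" where
  "ggd_Lambda \<sigma> \<alpha> = (1 / \<sigma>) * sqrt (Gamma (3 / \<alpha>) / Gamma (1 / \<alpha>))"

definition ggd_density :: "real \<Rightarrow> real \<Rightarrow> real \<Rightarrow> real \<Rightarrow> real" where
  "ggd_density \<mu> \<sigma> \<alpha> x =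
     \<alpha> * ggd_Lambda \<sigma> \<alpha> / (2 * Gamma (1 / \<alpha>))
       * exp (- (ggd_Lambda \<sigma> \<alpha> powr \<alpha>) * (\<bar>x - \<mu>\<bar> powr \<alpha>))"

text \<open>theta_alpha(s) = Gamma(-s) Gamma(1/alpha + 2s/alpha) / Gamma(1/2 + s);
  division by a Gamma value is written with the (entire) reciprocal Gamma function rGamma.\<close>
definition theta :: "real \<Rightarrow> complex \<Rightarrow> complex" where
  "theta \<alpha> s = Gamma (- s) * Gamma (of_real (1 / \<alpha>) + 2 * s / of_real \<alpha>) * rGamma (1 / 2 + s)"

definition G0_kernel :: "real \<Rightarrow> real \<Rightarrow> real \<Rightarrow> real \<Rightarrow> complex \<Rightarrow> complex \<Rightarrow> complex" where
  "G0_kernel \<alpha> \<beta> x y s u =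
     Gamma (1 / 2 + s + u) * rGamma (- s - u) * theta \<alpha> s * theta \<beta> u
       * (of_real x powr s) * (of_real y powr u)"

text \<open>Admissible vertical contours Re s = c1, Re u = c2: they separate the increasing pole
  sequence of Gamma(-s), Gamma(-u) (at 0,1,2,...) from the decreasing pole sequences of
  Gamma(1/alpha + 2s/alpha), Gamma(1/beta + 2u/beta) and Gamma(1/2 + s + u).\<close>
definition admissible_contour :: "real \<Rightarrow> real \<Rightarrow> bool" where
  "admissible_contour c1 c2 \<longleftrightarrow> -1/2 < c1 \<and> c1 < 0 \<and> -1/2 < c2 \<and> c2 < 0 \<and> -1/2 < c1 + c2"

text \<open>The bivariate Fox H-function G_0(x,y) as a double Mellin--Barnes integral along the
  vertical lines s = c1 + i t, u = c2 + i v: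
  (1/(2 pi i)^2) int int K(s,u) du ds = (1/(4 pi^2)) int int K(c1+it, c2+iv) dt dv.\<close>
definition G0 :: "real \<Rightarrow> real \<Rightarrow> real \<Rightarrow> real \<Rightarrow> real \<Rightarrow> real \<Rightarrow> complex" where
  "G0 \<alpha> \<beta> c1 c2 x y =
     (1 / (2 * pi * \<i>)^2) *
       (integral\<^sup>L (lborel :: (real \<times> real) measure)
          (\<lambda>(t, v). G0_kernel \<alpha> \<beta> x y (Complex c1 t) (Complex c2 v) * \<i> * \<i>))"

end

theory Submission
  imports Defs
begin

text \<open>
  By the Cahen--Mellin formula, \<open>exp (- w\<^sup>\<alpha>)\<close> is the Mellin--Barnes integral of
  \<open>\<Gamma>((1 + 2s)/\<alpha>) w\<^bsup>-1-2s\<^esup>\<close> along any line \<open>Re s = c > -1/2\<close>. Inserting this for both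
  densities turns the convolution of the densities into a double Mellin--Barnes integral of the
  convolutions of \<open>\<bar>x\<bar>\<^bsup>-1-2s\<^esup>\<close> and \<open>\<bar>x\<bar>\<^bsup>-1-2u\<^esup>\<close>, which Riesz' composition formula evaluates to
  gamma factors times \<open>\<bar>z\<bar>\<^bsup>-1-2s-2u\<^esup>\<close>. The admissible contours are exactly those on which the
  Riesz integral converges absolutely, and \<open>\<Gamma>\<close> is integrable on vertical lines, so Fubini's
  theorem applies.

  Euler's integrals are used in logarithmic variables, over the whole real line.
\<close>

section \<open>Interchange of integrals with explicit inner values\<close>

text \<open>The inner integrals enter through closed forms. By Tonelli, integrability of
  \<open>N\<close>, the inner integral of the norm, gives integrability on the product, and the
  value of \<open>B\<close> passes to \<open>A\<close>. \<open>N\<close> is complex-valued because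
  it usually arises from the same complex formula as \<open>B\<close>, taken at real
  parameters.\<close>

lemma Fubini_has_bochner_integral:
  fixes h :: "'a \<Rightarrow> 'b \<Rightarrow> complex"
  assumes "sigma_finite_measure M1" "sigma_finite_measure M2"
  assumes h[measurable]: "(\<lambda>(x, y). h x y) \<in> borel_measurable (M1 \<Otimes>\<^sub>M M2)"
    and A[measurable]: "A \<in> borel_measurable M1"
    and hA: "AE x in M1. has_bochner_integral M2 (\<lambda>y. h x y) (A x)"
    and hB: "AE y in M2. has_bochner_integral M1 (\<lambda>x. h x y) (B y)"
    and hN: "AE y in M2. has_bochner_integral M1 (\<lambda>x. complex_of_real (norm (h x y))) (N y)"
    and B: "has_bochner_integral M2 B I" and N: "integrable M2 N"
  shows "has_bochner_integral M1 A I"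
proof -
  interpret M1: sigma_finite_measure M1 by fact
  interpret M2: sigma_finite_measure M2 by fact
  interpret P: pair_sigma_finite M1 M2 ..
  interpret Q: pair_sigma_finite M2 M1 ..
  have h'[measurable]: "(\<lambda>(y, x). h x y) \<in> borel_measurable (M2 \<Otimes>\<^sub>M M1)"
    using measurable_pair_swap[OF h] by (simp add: case_prod_beta')
  have int': "integrable (M2 \<Otimes>\<^sub>M M1) (\<lambda>(y, x). h x y)"
  proof (rule Q.Fubini_integrable)
    have ReN: "integrable M2 (\<lambda>y. Re (N y))"
      using N by simp
    have "AE y in M2. Re (N y) = (\<integral>x. norm (h x y) \<partial>M1)"
      using hN
    proof eventually_elim
      case (elim y)
      from elim have "N y = complex_of_real (\<integral>x. norm (h x y) \<partial>M1)"
        by (simp add: has_bochner_integral_iff)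
      thus ?case by simp
    qed
    with ReN borel_measurable_integrable[OF ReN]
    show "integrable M2 (\<lambda>y. \<integral>x. norm (case (y, x) of (y, x) \<Rightarrow> h x y) \<partial>M1)"
      by (subst (asm) integrable_cong_AE) auto
    show "AE y in M2. integrable M1 (\<lambda>x. case (y, x) of (y, x) \<Rightarrow> h x y)"
      using hB by eventually_elim (simp add: has_bochner_integral_iff)
  qed fact
  hence int: "integrable (M1 \<Otimes>\<^sub>M M2) (\<lambda>(x, y). h x y)"
    using Q.integrable_product_swap_iff[of "\<lambda>(y, x). h x y"] by (simp add: case_prod_beta')
  have AEA: "AE x in M1. A x = (\<integral>y. h x y \<partial>M2)"
    using hA by eventually_elim (simp add: has_bochner_integral_iff)
  have AEB: "AE y in M2. B y = (\<integral>x. h x y \<partial>M1)"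
    using hB by eventually_elim (simp add: has_bochner_integral_iff)
  have "integrable M1 (\<lambda>x. \<integral>y. h x y \<partial>M2)"
    using P.integrable_fst'[OF int] by simp
  hence "integrable M1 A"
    using AEA by (subst integrable_cong_AE) auto
  moreover have "integral\<^sup>L M1 A = I"
  proof -
    have "integral\<^sup>L M1 A = (\<integral>x. \<integral>y. h x y \<partial>M2 \<partial>M1)"
      using AEA by (intro integral_cong_AE) auto
    also have "\<dots> = (\<integral>y. \<integral>x. h x y \<partial>M1 \<partial>M2)"
      using P.Fubini_integral[OF int] by simp
    also have "\<dots> = integral\<^sup>L M2 B"
      using AEB B by (intro integral_cong_AE) (auto simp: has_bochner_integral_iff)
    also have "\<dots> = I" using B by (simp add: has_bochner_integral_iff)
    finally show ?thesis .
  qed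
  ultimately show ?thesis by (simp add: has_bochner_integral_iff)
qed

lemmas Fubini_has_bochner_integral_lborel =
  Fubini_has_bochner_integral[OF sigma_finite_lborel sigma_finite_lborel]

lemma has_bochner_integral_lborel_shift:
  fixes f :: "real \<Rightarrow> complex"
  shows "has_bochner_integral lborel (\<lambda>x. f (x + t)) I \<longleftrightarrow> has_bochner_integral lborel f I"
  using lborel_has_bochner_integral_real_affine_iff[of 1 f I t] by (simp add: add.commute)

section \<open>Cancellation of Gamma factors and complex powers of positive reals\<close>

lemma rGamma_mult_Gamma:
  fixes z :: complex
  assumes "Re z > 0"
  shows "rGamma z * Gamma z = 1"
  using assms Gamma_eq_zero_iff[of z] by (auto simp: rGamma_inverse_Gamma elim!: nonpos_Ints_cases)

lemma Gamma_mult_rGamma_cancel: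
  fixes z :: complex
  assumes "Re z > 0"
  shows "Gamma z * x * rGamma z = x"
  using rGamma_mult_Gamma[OF assms] by (simp add: mult.commute mult.left_commute)

text \<open>
  Agrees with \<open>powr\<close> for positive \<open>x\<close> only: \<open>cpow 0 z = 1\<close> since \<open>ln 0 = 0\<close>.
\<close>
definition cpow :: "real \<Rightarrow> complex \<Rightarrow> complex" where
  "cpow x z = exp (z * of_real (ln x))"

lemma powr_eq_cpow: "x > 0 \<Longrightarrow> complex_of_real x powr z = cpow x z"
  by (simp add: cpow_def powr_def Ln_of_real)

lemma cpow_add: "cpow x (z + w) = cpow x z * cpow x w"
  by (simp add: cpow_def ring_distribs exp_add)

lemma cpow_mult: "x > 0 \<Longrightarrow> y > 0 \<Longrightarrow> cpow (x * y) z = cpow x z * cpow y z"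
  by (simp add: cpow_def ring_distribs exp_add ln_mult)

lemma cpow_divide: "x > 0 \<Longrightarrow> y > 0 \<Longrightarrow> cpow (x / y) z = cpow x z * cpow y (- z)"
  by (simp add: cpow_def ring_distribs exp_add exp_diff exp_minus field_simps ln_div)

lemma cpow_minus: "cpow x (-z) = 1 / cpow x z"
  by (simp add: cpow_def exp_minus field_simps)

lemma cpow_nonzero [simp]: "cpow x z \<noteq> 0"
  by (simp add: cpow_def)

lemma cpow_exp [simp]: "cpow (exp x) z = exp (z * of_real x)"
  by (simp add: cpow_def)

text \<open>Phrased as an equation of complex numbers so that the norm of an integrand is again an
  integrand of the same family, with real parameters. This is how the \<open>N\<close> of the Fubini
  lemma is obtained.\<close>

lemma norm_cpow: "complex_of_real (norm (cpow x z)) = cpow x (of_real (Re z))"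
  by (simp add: cpow_def flip: exp_of_real)

lemma norm_exp_times_real: "complex_of_real (norm (exp (z * of_real x))) = exp (of_real (Re z) * of_real x)"
  by (simp flip: exp_of_real)

lemma cpow_measurable [measurable (raw)]:
  "f \<in> borel_measurable M \<Longrightarrow> (\<lambda>x. cpow (f x) z) \<in> borel_measurable M"
  unfolding cpow_def by measurable

section \<open>Euler's integrals in logarithmic variables\<close>

text \<open>Substitute \<open>t = exp x\<close> in Euler's integral; the Jacobian
  \<open>exp x\<close> turns the exponent \<open>z - 1\<close> into \<open>z\<close>.\<close>

lemma has_bochner_integral_Gamma_exp:
  assumes "Re z > 0"
  shows "has_bochner_integral lborel (\<lambda>x::real. exp (z * of_real x) * of_real (exp (- exp x))) (Gamma z)"
proof -
  let ?f = "\<lambda>t. of_real t powr (z - 1) / of_real (exp t) :: complex"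
  let ?g = "\<lambda>x::real. exp (z * of_real x) * of_real (exp (- exp x)) :: complex"
  have im: "range (exp :: real \<Rightarrow> real) = {0<..}"
    by (auto simp: image_iff) (metis exp_ln)
  have eq: "\<bar>exp x\<bar> *\<^sub>R ?f (exp x) = ?g x" for x :: real
    by (simp add: powr_def Ln_of_real scaleR_conv_of_real exp_diff exp_minus field_simps flip: exp_of_real)
  have "?f absolutely_integrable_on range exp \<and> integral (range exp) ?f = Gamma z"
    unfolding im using absolutely_integrable_Gamma_integral'[OF assms] Gamma_integral_complex'[OF assms]
    by (auto simp: has_integral_iff)
  hence "(\<lambda>x. \<bar>exp x\<bar> *\<^sub>R ?f (exp x)) absolutely_integrable_on UNIV \<and>
         integral UNIV (\<lambda>x. \<bar>exp x\<bar> *\<^sub>R ?f (exp x)) = Gamma z"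
    by (subst has_absolute_integral_change_of_variables_real)
       (auto intro!: derivative_eq_intros simp: inj_on_def)
  hence *: "?g absolutely_integrable_on UNIV" "integral UNIV ?g = Gamma z"
    by (simp_all only: eq)
  have "integrable lebesgue ?g"
    using *(1) by (simp add: set_integrable_def)
  hence "integrable lborel ?g"
    by (subst (asm) integrable_completion) auto
  thus ?thesis
    using *(2) integral_lborel[of ?g] by (simp add: has_bochner_integral_iff)
qed

text \<open>The factor \<open>c\<close> amounts to a shift of \<open>x\<close> by
  \<open>ln c\<close>, under which Lebesgue measure is invariant.\<close>

lemma has_bochner_integral_Gamma_exp_scaled:
  assumes "Re z > 0" "c > 0"
  shows "has_bochner_integral lborel
           (\<lambda>x::real. exp (z * of_real x) * of_real (exp (- (c * exp x)))) (Gamma z * cpow c (-z))"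
proof -
  have "has_bochner_integral lborel
     (\<lambda>x::real. exp (z * of_real (x + ln c)) * of_real (exp (- exp (x + ln c)))) (Gamma z)"
    using has_bochner_integral_Gamma_exp[OF assms(1)]
      has_bochner_integral_lborel_shift[of "\<lambda>x. exp (z * of_real x) * of_real (exp (- exp x))" "ln c"]
    by blast
  from has_bochner_integral_mult_left[OF this, of "cpow c (-z)"] show ?thesis
    using assms(2) by (rule_tac has_bochner_integral_cong[THEN iffD1, rotated -1])
       (auto simp: cpow_def exp_add ring_distribs exp_minus field_simps)
qed

text \<open>The classical Beta integral: write \<open>Gamma p * cpow (1 + exp y) (-p)\<close> as a
  scaled Gamma integral over \<open>r\<close> and integrate over \<open>y\<close> first. Each of the
  two remaining integrals is again of Gamma type.\<close>

lemma has_bochner_integral_Beta_exp: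
  assumes "Re b > 0" "Re p > Re b"
  shows "has_bochner_integral lborel (\<lambda>y::real. exp (b * of_real y) * cpow (1 + exp y) (-p))
           (Gamma b * Gamma (p - b) * rGamma p)"
proof -
  let ?h = "\<lambda>y r. exp (b * of_real y) * (exp (p * of_real r) * of_real (exp (- ((1 + exp y) * exp r))))"
  have hA: "has_bochner_integral lborel (?h y) (Gamma p * (exp (b * of_real y) * cpow (1 + exp y) (-p)))"
for y :: real
    using has_bochner_integral_mult_right[OF
      has_bochner_integral_Gamma_exp_scaled[of p "1 + exp y"], of "exp (b * of_real y)"] assms
    by (simp add: add_pos_pos mult_ac)
  \<comment> \<open>Kept general in \<open>b\<close> and \<open>p\<close>: the real parts of the
    given parameters are inserted later, which yields the integral of the norm.\<close>
  have hB: "has_bochner_integral lborel (\<lambda>y. exp (b * of_real y) * (exp (p * of_real r) * of_real (exp (- ((1 + exp y) * exp r)))))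
      (Gamma b * (exp ((p - b) * of_real r) * of_real (exp (- exp r))))"
    if "Re b > 0" for r :: real and b p
  proof -
    have *: "exp ((p - b) * of_real r) = exp (p * of_real r) * cpow (exp r) (-b)"
      by (simp add: ring_distribs exp_diff exp_minus field_simps)
    show ?thesis
      using has_bochner_integral_mult_right[OF
        has_bochner_integral_Gamma_exp_scaled[of b "exp r"], of "exp (p * of_real r) * of_real (exp (- exp r))"] that
      by (simp add: * mult_ac exp_add ring_distribs exp_diff exp_minus divide_inverse)
  qed
  have "has_bochner_integral lborel (\<lambda>y. Gamma p * (exp (b * of_real y) * cpow (1 + exp y) (-p)))
          (Gamma b * Gamma (p - b))"
  proof (rule Fubini_has_bochner_integral_lborel)
    show "(\<lambda>(y, r). ?h y r) \<in> borel_measurable (lborel \<Otimes>\<^sub>M lborel)"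
      by measurable
    show "(\<lambda>y. Gamma p * (exp (b * of_real y) * cpow (1 + exp y) (-p))) \<in> borel_measurable lborel"
      by measurable
    show "AE y in lborel. has_bochner_integral lborel (?h y) (Gamma p * (exp (b * of_real y) * cpow (1 + exp y) (-p)))"
      using hA assms by blast
    show "AE r in lborel. has_bochner_integral lborel (\<lambda>y. ?h y r) (Gamma b * (exp ((p - b) * of_real r) * of_real (exp (- exp r))))"
      using hB assms by blast
    show "AE r in lborel. has_bochner_integral lborel (\<lambda>y. complex_of_real (norm (?h y r)))
       (Gamma (of_real (Re b)) * (exp ((of_real (Re p) - of_real (Re b)) * of_real r) * of_real (exp (- exp r))))"
      using hB[of "of_real (Re b)" "of_real (Re p)"] assms(1)
      by (simp add: norm_mult norm_exp_times_real del: norm_exp_eq_Re)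
    show "has_bochner_integral lborel (\<lambda>r. Gamma b * (exp ((p - b) * of_real r) * of_real (exp (- exp r)))) (Gamma b * Gamma (p - b))"
      by (intro has_bochner_integral_mult_right has_bochner_integral_Gamma_exp) (use assms in auto)
    show "integrable lborel (\<lambda>r. Gamma (of_real (Re b)) * (exp ((of_real (Re p) - of_real (Re b)) * complex_of_real r) * of_real (exp (- exp r))))"
      using has_bochner_integral_Gamma_exp[of "of_real (Re p) - of_real (Re b)"] assms
      by (intro integrable_mult_right) (auto simp: has_bochner_integral_iff)
  qed
  from has_bochner_integral_mult_left[OF this, of "rGamma p"] show ?thesis
    using assms by (simp add: Gamma_mult_rGamma_cancel)
qed

lemma has_bochner_integral_gaussian:
  assumes "c > 0"
  shows "has_bochner_integral lborel (\<lambda>y::real. exp (- (c * y\<^sup>2))) (sqrt (pi / c))"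
proof -
  define \<sigma> where "\<sigma> = 1 / sqrt (2 * c)"
  have \<sigma>: "\<sigma> > 0" "\<sigma>\<^sup>2 = 1 / (2 * c)"
    using assms by (simp_all add: \<sigma>_def power_divide)
  have "has_bochner_integral lborel (\<lambda>y. sqrt (pi / c) * normal_density 0 \<sigma> y) (sqrt (pi / c) * 1)"
    using \<sigma>(1) by (intro has_bochner_integral_mult_right)
      (simp add: has_bochner_integral_iff)
  moreover have "sqrt (pi / c) * normal_density 0 \<sigma> y = exp (- (c * y\<^sup>2))" for y
    using assms by (simp add: normal_density_def \<sigma>(2) mult.commute)
  ultimately show ?thesis by simp
qed

text \<open>The power is again replaced by a Gamma integral over \<open>r\<close>. The
  \<open>y\<close>-integral is now Gaussian and contributes \<open>exp (- (r / 2))\<close>, which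
  lowers the Gamma parameter from \<open>p\<close> to \<open>p - 1/2\<close>.\<close>

lemma has_bochner_integral_cpow_one_plus_square:
  assumes "Re p > 1/2"
  shows "has_bochner_integral lborel (\<lambda>y::real. cpow (1 + y\<^sup>2) (-p))
           (of_real (sqrt pi) * Gamma (p - 1/2) * rGamma p)"
proof -
  let ?h = "\<lambda>y r. exp (p * of_real r) * of_real (exp (- ((1 + y\<^sup>2) * exp r)))"
  have hA: "has_bochner_integral lborel (?h y) (Gamma p * cpow (1 + y\<^sup>2) (-p))" for y :: real
    using assms by (intro has_bochner_integral_Gamma_exp_scaled) (auto simp: add_pos_nonneg)
  have hB: "has_bochner_integral lborel
      (\<lambda>y. exp (p * of_real r) * of_real (exp (- ((1 + y\<^sup>2) * exp r))))
      (of_real (sqrt pi) * (exp ((p - 1/2) * of_real r) * of_real (exp (- exp r))))"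
    for r :: real and p :: complex
  proof -
    have *: "sqrt (pi / exp r) = sqrt pi * exp (- (r / 2))"
      by (rule real_sqrt_unique) (simp_all add: power_mult_distrib exp_minus field_simps flip: exp_double)
    have "has_bochner_integral lborel (\<lambda>y::real. complex_of_real (exp (- (exp r * y\<^sup>2)))) (of_real (sqrt pi * exp (- (r / 2))))"
      by (intro has_bochner_integral_of_real has_bochner_integral_gaussian[of "exp r", unfolded *]) auto
    from has_bochner_integral_mult_right[OF this, of "exp (p * of_real r) * of_real (exp (- exp r))"]
    moreover have "exp ((p - 1/2) * of_real r) = exp (p * of_real r) * of_real (exp (- (r / 2)))"
      by (simp add: left_diff_distrib flip: exp_of_real exp_add)
    moreover have "exp (- ((1 + y\<^sup>2) * exp r)) = exp (- exp r) * exp (- (exp r * y\<^sup>2))" for y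
      by (simp add: ring_distribs flip: exp_add)
    ultimately show ?thesis
      by (simp add: mult_ac)
  qed
  have "has_bochner_integral lborel (\<lambda>y. Gamma p * cpow (1 + y\<^sup>2) (-p))
          (of_real (sqrt pi) * Gamma (p - 1/2))"
  proof (rule Fubini_has_bochner_integral_lborel)
    show "(\<lambda>(y, r). ?h y r) \<in> borel_measurable (lborel \<Otimes>\<^sub>M lborel)"
      by measurable
    show "(\<lambda>y. Gamma p * cpow (1 + y\<^sup>2) (-p)) \<in> borel_measurable lborel"
      by measurable
    show "AE y in lborel. has_bochner_integral lborel (?h y) (Gamma p * cpow (1 + y\<^sup>2) (-p))"
      using hA by blast
    show "AE r in lborel. has_bochner_integral lborel (\<lambda>y. ?h y r)
        (of_real (sqrt pi) * (exp ((p - 1/2) * of_real r) * of_real (exp (- exp r))))"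
      using hB by blast
    show "AE r in lborel. has_bochner_integral lborel (\<lambda>y. complex_of_real (norm (?h y r)))
        (of_real (sqrt pi) * (exp ((of_real (Re p) - 1/2) * of_real r) * of_real (exp (- exp r))))"
      using hB[of "of_real (Re p)"]
      by (simp add: norm_mult norm_exp_times_real del: norm_exp_eq_Re)
    show "has_bochner_integral lborel (\<lambda>r. of_real (sqrt pi) * (exp ((p - 1/2) * of_real r) * of_real (exp (- exp r))))
       (of_real (sqrt pi) * Gamma (p - 1/2))"
      by (intro has_bochner_integral_mult_right has_bochner_integral_Gamma_exp) (use assms in auto)
    show "integrable lborel (\<lambda>r. of_real (sqrt pi) * (exp ((of_real (Re p) - 1/2) * complex_of_real r) * of_real (exp (- exp r))))"
      using has_bochner_integral_Gamma_exp[of "of_real (Re p) - 1/2"] assms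
      by (intro integrable_mult_right) (auto simp: has_bochner_integral_iff)
  qed
  from has_bochner_integral_mult_left[OF this, of "rGamma p"] show ?thesis
    using assms by (simp add: Gamma_mult_rGamma_cancel)
qed

section \<open>Riesz' composition formula\<close>

text \<open>
  Feynman's parametrisation of \<open>P\<^bsup>-A\<^esup> Q\<^bsup>-B\<^esup>\<close>. With \<open>P = x\<^sup>2\<close> and
  \<open>Q = (1 - x)\<^sup>2\<close> the integrand becomes a power of a positive definite quadratic
  polynomial in \<open>x\<close>, so that the \<open>x\<close>-integration in the Riesz formula is elementary.
\<close>
lemma has_bochner_integral_feynman:
  fixes P Q :: real
  assumes "Re A > 0" "Re B > 0" "P > 0" "Q > 0"
  shows "has_bochner_integral lborel (\<lambda>k::real. exp (B * of_real k) * cpow (P + Q * exp k) (-(A + B)))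
           (Gamma A * Gamma B * rGamma (A + B) * cpow P (-A) * cpow Q (-B))"
proof -
  \<comment> \<open>Shifting the Beta integral by this amount turns \<open>1 + exp k\<close> into
    \<open>(P + Q * exp k) / P\<close>.\<close>
  define L where "L = ln (Q / P)"
  have L: "exp (k + L) = exp k * Q / P" for k
    using assms by (simp add: L_def exp_add)
  have eB: "exp (B * of_real L) = cpow Q B * cpow P (-B)"
    using assms by (simp add: L_def cpow_divide flip: cpow_def)
  have "has_bochner_integral lborel (\<lambda>k::real. exp (B * of_real (k + L)) * cpow (1 + exp (k + L)) (-(A + B)))
     (Gamma B * Gamma A * rGamma (A + B))"
    using has_bochner_integral_Beta_exp[of B "A + B"] assms
    has_bochner_integral_lborel_shift[of "\<lambda>k. exp (B * of_real k) * cpow (1 + exp k) (-(A + B))" L]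
    by auto
  hence "has_bochner_integral lborel (\<lambda>k::real. exp (B * of_real (k + L)) * cpow (1 + exp (k + L)) (-(A + B)) * (cpow P (-A) * cpow Q (-B)))
     (Gamma B * Gamma A * rGamma (A + B) * (cpow P (-A) * cpow Q (-B)))"
    by (rule has_bochner_integral_mult_left)
  moreover have "exp (B * of_real (k + L)) * cpow (1 + exp (k + L)) (-(A + B)) * (cpow P (-A) * cpow Q (-B)) =
     exp (B * of_real k) * cpow (P + Q * exp k) (-(A + B))" for k
  proof -
    have "1 + exp (k + L) = (P + Q * exp k) / P"
      using assms unfolding L by (simp add: field_simps)
    hence "cpow (1 + exp (k + L)) (-(A + B)) = cpow (P + Q * exp k) (-(A+B)) * cpow P (A + B)"
      using assms by (simp add: cpow_divide add_pos_pos add.commute)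
    thus ?thesis
      by (simp add: ring_distribs exp_add eB cpow_minus cpow_add field_simps)
  qed
  ultimately show ?thesis by (simp add: mult_ac)
qed

text \<open>True also for \<open>x = 0\<close>, where both sides are 1.\<close>

lemma cpow_square: "cpow (x\<^sup>2) z = cpow \<bar>x\<bar> (2 * z)"
proof (cases "x = 0")
  case False
  hence "cpow (\<bar>x\<bar> * \<bar>x\<bar>) z = cpow \<bar>x\<bar> (z + z)"
    unfolding cpow_add by (intro cpow_mult) auto
  thus ?thesis by (simp add: power2_eq_square flip: mult_2)
qed (simp add: cpow_def)

text \<open>Completing the square makes the quadratic polynomial a constant multiple of
  \<open>1 + y\<^sup>2\<close>, whose powers have already been integrated.\<close>

lemma has_bochner_integral_cpow_quadratic:
  fixes k :: real
  assumes "Re p > 1/2"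
  shows "has_bochner_integral lborel (\<lambda>x::real. cpow (x\<^sup>2 + (1 - x)\<^sup>2 * exp k) (-p))
     (exp ((1/2 - p) * of_real k) * cpow (1 + exp k) (p - 1) * (of_real (sqrt pi) * Gamma (p - 1/2) * rGamma p))"
    (is "has_bochner_integral _ ?f (?c * ?I)")
proof -
  define w where "w = 1 + exp k"
  have w: "w > 0" by (simp add: w_def add_pos_pos)
  \<comment> \<open>With \<open>w\<close> as leading coefficient, the quadratic has its minimum
    \<open>exp k / w\<close> at \<open>t\<close>; \<open>c\<close> is chosen so that
    \<open>w * c\<^sup>2\<close> equals this minimum too.\<close>
  define t where "t = exp k / w"
  define c where "c = exp (k / 2) / w"
  have c: "c > 0" using w by (simp add: c_def)
  have e: "exp k = exp (k / 2) ^ 2" by (simp flip: exp_double)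
  have "(t + c * y)\<^sup>2 + (1 - (t + c * y))\<^sup>2 * exp k = exp k / w * (1 + y\<^sup>2)" for y
  proof -
    have "(t + c * y)\<^sup>2 + (1 - (t + c * y))\<^sup>2 * exp k =
       w * (t + c * y)\<^sup>2 - 2 * exp k * (t + c * y) + exp k"
      by (simp add: w_def power2_eq_square algebra_simps)
    also have "w * (t + c * y)\<^sup>2 - 2 * exp k * (t + c * y) + exp k =
      w * ((exp k + exp (k/2) * y) / w)\<^sup>2 - 2 * exp k * ((exp k + exp (k/2) * y) / w) + exp k"
      by (simp add: t_def c_def add_divide_distrib)
    also have "\<dots> =
      (exp k + exp (k/2) * y)\<^sup>2 / w - 2 * exp k * (exp k + exp (k/2) * y) / w + exp k * w / w"
      using w by (simp add: power2_eq_square)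
    also have "\<dots> = ((exp k + exp (k/2) * y)\<^sup>2 - 2 * exp k * (exp k + exp (k/2) * y) + exp k * (1 + exp k)) / w"
      by (simp add: w_def add_divide_distrib diff_divide_distrib)
    also have "\<dots> = exp k / w * (1 + y\<^sup>2)"
      by (simp add: e) (simp add: power2_eq_square algebra_simps)
    finally show ?thesis .
  qed
  hence eq: "?f (t + c * y) = cpow (exp k / w) (-p) * cpow (1 + y\<^sup>2) (-p)" for y
    using w cpow_mult[of "exp k / w" "1 + y\<^sup>2" "-p"] by (simp only:) (simp add: add_pos_nonneg)
  have "?c = of_real c * cpow (exp k / w) (-p)"
  proof -
    have "complex_of_real c = cpow (exp (k/2) / w) 1"
      using c by (simp add: c_def cpow_def exp_of_real)
    hence "of_real c * cpow (exp k / w) (-p) =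
      exp (of_real (k/2)) * exp (- p * of_real k) * (cpow w (-1) * cpow w p)"
      using w by (simp add: cpow_divide mult_ac)
    also have "\<dots> = ?c"
      by (simp add: ring_distribs w_def flip: exp_add cpow_add)
    finally show ?thesis ..
  qed
  moreover have "has_bochner_integral lborel (\<lambda>y. ?f (t + c * y)) (cpow (exp k / w) (-p) * ?I)"
    unfolding eq by (intro has_bochner_integral_mult_right has_bochner_integral_cpow_one_plus_square assms)
  ultimately show ?thesis
    using c by (subst lborel_has_bochner_integral_real_affine_iff[of c _ _ t])
      (auto simp: scaleR_conv_of_real simp flip: mult.assoc)
qed

text \<open>Riesz' composition formula for the kernels \<open>\<bar>x\<bar>\<^bsup>-2A\<^esup>\<close> and \<open>\<bar>x\<bar>\<^bsup>-2B\<^esup>\<close>, at the point \<open>1\<close>.\<close>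
lemma has_bochner_integral_riesz_01:
  assumes "Re A < 1/2" "Re B < 1/2" "Re (A + B) > 1/2"
  shows "has_bochner_integral lborel (\<lambda>x::real. cpow \<bar>x\<bar> (-(2*A)) * cpow \<bar>1 - x\<bar> (-(2*B)))
           (of_real (sqrt pi) * Gamma (1/2 - A) * Gamma (1/2 - B) * Gamma (A + B - 1/2)
              * rGamma A * rGamma B * rGamma (1 - A - B))"
proof -
  have AB: "Re A > 0" "Re B > 0" using assms by auto
  let ?h = "\<lambda>x k. exp (B * of_real k) * cpow (x\<^sup>2 + (1 - x)\<^sup>2 * exp k) (-(A + B))"
  let ?G = "Gamma A * Gamma B * rGamma (A + B)"
  let ?f = "\<lambda>x::real. cpow \<bar>x\<bar> (-(2*A)) * cpow \<bar>1 - x\<bar> (-(2*B))"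
  \<comment> \<open>The value of the inner \<open>x\<close>-integral. As a function of
    \<open>k\<close> it is a Beta integrand in logarithmic form.\<close>
  define H where "H = (\<lambda>A B k. 
        (of_real (sqrt pi) * Gamma (A + B - 1/2) * rGamma (A + B)) *
        (exp ((1/2 - A) * of_real k) * cpow (1 + exp k) (-(1 - A - B))))"
  have hA: "has_bochner_integral lborel (?h x) (?G * ?f x)" if "x \<noteq> 0" "x \<noteq> 1" for x
    using has_bochner_integral_feynman[OF AB, of "x\<^sup>2" "(1-x)\<^sup>2"] that
    by (simp add: cpow_square mult_ac)
  have hB: "has_bochner_integral lborel (\<lambda>x. exp (B * of_real k) * cpow (x\<^sup>2 + (1 - x)\<^sup>2 * exp k) (-(A + B)))
      (H A B k)" if "Re (A + B) > 1/2" for k :: real and A B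
  proof -
    have "exp ((1/2 - A) * of_real k) = exp (B * complex_of_real k) * exp ((1/2 - (A + B)) * of_real k)"
      by (simp add: algebra_simps flip: exp_add)
    with has_bochner_integral_mult_right[OF has_bochner_integral_cpow_quadratic[OF that, of k], of "exp (B * of_real k)"]
    show ?thesis by (simp add: H_def mult_ac diff_diff_eq)
  qed
  have intH: "has_bochner_integral lborel (H A B) 
     (of_real (sqrt pi) * Gamma (A + B - 1/2) * rGamma (A + B) *
       (Gamma (1/2 - A) * Gamma (1/2 - B) * rGamma (1 - A - B)))"
    if "Re A < 1/2" "Re B < 1/2" "Re (A + B) > 1/2" for A B
    \<comment> \<open>The conditions of the Beta integral become \<open>Re A < 1/2\<close> and
      \<open>Re B < 1/2\<close>.\<close>
    unfolding H_def using has_bochner_integral_Beta_exp[of "1/2 - A" "1 - A - B"] that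
    by (intro has_bochner_integral_mult_right) (simp add: algebra_simps)
  have "has_bochner_integral lborel (\<lambda>x. ?G * ?f x)
          (of_real (sqrt pi) * Gamma (A + B - 1/2) * rGamma (A + B) *
       (Gamma (1/2 - A) * Gamma (1/2 - B) * rGamma (1 - A - B)))"
  proof (rule Fubini_has_bochner_integral_lborel)
    show "(\<lambda>(x, k). ?h x k) \<in> borel_measurable (lborel \<Otimes>\<^sub>M lborel)"
      by measurable
    show "(\<lambda>x. ?G * ?f x) \<in> borel_measurable lborel"
      by measurable
    show "AE x in lborel. has_bochner_integral lborel (?h x) (?G * ?f x)"
      \<comment> \<open>At \<open>x = 0\<close> and \<open>x = 1\<close> one of the two squares
        vanishes, so Feynman's formula does not apply.\<close>
      using AE_lborel_singleton[of "0::real"] AE_lborel_singleton[of "1::real"]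
      by eventually_elim (rule hA)
    show "AE k in lborel. has_bochner_integral lborel (\<lambda>x. ?h x k) (H A B k)"
      using hB assms by blast
    show "AE k in lborel. has_bochner_integral lborel (\<lambda>x. complex_of_real (norm (?h x k)))
        (H (of_real (Re A)) (of_real (Re B)) k)"
      using hB[of "of_real (Re A)" "of_real (Re B)"] assms
      by (simp add: norm_mult norm_exp_times_real norm_cpow del: norm_exp_eq_Re)
    show "has_bochner_integral lborel (H A B) (of_real (sqrt pi) * Gamma (A + B - 1/2) * rGamma (A + B) *
       (Gamma (1/2 - A) * Gamma (1/2 - B) * rGamma (1 - A - B)))"
      by (rule intH) (use assms in auto)
    show "integrable lborel (H (of_real (Re A)) (of_real (Re B)))"
      using intH[of "of_real (Re A)" "of_real (Re B)"] assms
      by (auto simp: has_bochner_integral_iff)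
  qed
  \<comment> \<open>This multiplier clears the Feynman constant on the left;
    \<open>Gamma (A + B)\<close> also cancels the reciprocal left by the quadratic integral on the
    right.\<close>
  from has_bochner_integral_mult_right[OF this, of "rGamma A * rGamma B * Gamma (A + B)"]
  have "has_bochner_integral lborel
    (\<lambda>x. (rGamma A * Gamma A) * (rGamma B * Gamma B) * (rGamma (A + B) * Gamma (A + B)) * ?f x)
    ((rGamma (A + B) * Gamma (A + B)) * (of_real (sqrt pi) * Gamma (1/2 - A) * Gamma (1/2 - B)
       * Gamma (A + B - 1/2) * rGamma A * rGamma B * rGamma (1 - A - B)))"
    by (simp only: mult_ac)
  thus ?thesis
    using rGamma_mult_Gamma[of A] rGamma_mult_Gamma[of B] rGamma_mult_Gamma[of "A + B"] AB by simp
qed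

text \<open>By homogeneity, replacing \<open>x\<close> by \<open>d * x\<close> reduces this to the
  point 1; the Jacobian raises the exponent \<open>-2*A - 2*B\<close> of the modulus of
  \<open>d\<close> by one.\<close>

lemma has_bochner_integral_riesz:
  fixes d :: real
  assumes "Re A < 1/2" "Re B < 1/2" "Re (A + B) > 1/2" "d \<noteq> 0"
  shows "has_bochner_integral lborel (\<lambda>x::real. cpow \<bar>x\<bar> (-(2*A)) * cpow \<bar>d - x\<bar> (-(2*B)))
           (of_real (sqrt pi) * Gamma (1/2 - A) * Gamma (1/2 - B) * Gamma (A + B - 1/2)
              * rGamma A * rGamma B * rGamma (1 - A - B) * cpow \<bar>d\<bar> (1 - 2*A - 2*B))"
    (is "has_bochner_integral _ ?f (?R * _)")
proof -
  have "has_bochner_integral lborel (\<lambda>x. cpow \<bar>d\<bar> (-(2*A) - 2*B) *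
      (cpow (\<bar>x\<bar>) (-(2*A)) * cpow (\<bar>1 - x\<bar>) (-(2*B)))) (cpow \<bar>d\<bar> (-(2*A) - 2*B) * ?R)"
    by (intro has_bochner_integral_mult_right has_bochner_integral_riesz_01 assms)
  \<comment> \<open>Multiplicativity of \<open>cpow\<close> needs positive bases, so the zeros 0 and
    1 of the two factors are excluded.\<close>
  moreover have "AE x in lborel. cpow \<bar>d\<bar> (-(2*A) - 2*B) *
      (cpow \<bar>x\<bar> (-(2*A)) * cpow \<bar>1 - x\<bar> (-(2*B))) = ?f (0 + d * x)"
    using AE_lborel_singleton[of "0::real"] AE_lborel_singleton[of "1::real"]
  proof eventually_elim
    case (elim x)
    have "\<bar>d - d * x\<bar> = \<bar>d\<bar> * \<bar>1 - x\<bar>" by (simp add: right_diff_distrib flip: abs_mult)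
    thus ?case using elim assms(4)
      by (simp add: abs_mult cpow_mult cpow_add[of _ "-(2*A)" "-(2*B)", unfolded add_uminus_conv_diff])
  qed
  ultimately have "has_bochner_integral lborel (\<lambda>x. ?f (0 + d * x)) (cpow \<bar>d\<bar> (-(2*A) - 2*B) * ?R)"
    by (subst (asm) has_bochner_integral_cong_AE) auto
  moreover have "cpow \<bar>d\<bar> (1 - 2*A - 2*B) /\<^sub>R \<bar>d\<bar> = cpow \<bar>d\<bar> (-(2*A) - 2*B)"
  proof -
    have "cpow \<bar>d\<bar> (1 - 2*A - 2*B) = of_real \<bar>d\<bar> * cpow \<bar>d\<bar> (-(2*A) - 2*B)"
    using assms(4) cpow_add[of "\<bar>d\<bar>" 1 "-(2*A) - 2*B"]
      by (simp add: cpow_def[of _ 1] exp_of_real algebra_simps)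
    thus ?thesis using assms(4) by (simp add: scaleR_conv_of_real)
  qed
  hence "(?R * cpow \<bar>d\<bar> (1 - 2*A - 2*B)) /\<^sub>R \<bar>d\<bar> = cpow \<bar>d\<bar> (-(2*A) - 2*B) * ?R"
    by (subst mult_scaleR_right[symmetric]) (simp only: mult.commute)
  ultimately show ?thesis
    using assms(4) by (subst lborel_has_bochner_integral_real_affine_iff[of d _ _ 0]) simp_all
qed

section \<open>Size and integrability of Gamma on vertical lines\<close>

text \<open>Taking the norm inside Euler's integral replaces \<open>z\<close> by its real
  part.\<close>

lemma norm_Gamma_le_Gamma_Re:
  fixes z :: complex
  assumes "Re z > 0"
  shows "norm (Gamma z) \<le> Gamma (Re z)"
proof -
  let ?f = "\<lambda>z x. exp (z * complex_of_real x) * of_real (exp (- exp x))"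
  have 1: "has_bochner_integral lborel (?f z) (Gamma z)"
    by (rule has_bochner_integral_Gamma_exp) fact
  have 2: "has_bochner_integral lborel (?f (of_real (Re z))) (of_real (Gamma (Re z)))"
    using has_bochner_integral_Gamma_exp[of "of_real (Re z)"] assms by (simp add: Gamma_complex_of_real)
  have "?f (of_real (Re z)) x = of_real (norm (?f z x))" for x
    by (simp add: norm_mult norm_exp_times_real del: norm_exp_eq_Re)
  with 2 have "has_bochner_integral lborel (\<lambda>x. complex_of_real (norm (?f z x))) (of_real (Gamma (Re z)))"
    by simp
  hence "complex_of_real (\<integral>x. norm (?f z x) \<partial>lborel) = of_real (Gamma (Re z))"
    by (simp add: has_bochner_integral_iff del: norm_exp_eq_Re)
  hence "(\<integral>x. norm (?f z x) \<partial>lborel) = Gamma (Re z)"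
    by (simp only: of_real_eq_iff)
  moreover have "norm (integral\<^sup>L lborel (?f z)) \<le> (\<integral>x. norm (?f z x) \<partial>lborel)"
    by (rule integral_norm_bound)
  ultimately show ?thesis using 1 by (simp add: has_bochner_integral_iff)
qed

lemma integrable_inverse_one_plus_square: "integrable lborel (\<lambda>t::real. 1 / (1 + t\<^sup>2))"
proof -
  have *: "cpow (1 + t\<^sup>2) (-1) = of_real (1 / (1 + t\<^sup>2))" for t :: real
    using add_pos_nonneg[of 1 "t\<^sup>2"]
    by (simp add: cpow_def exp_minus field_simps exp_of_real flip: of_real_minus)
  have "integrable lborel (\<lambda>t::real. complex_of_real (1 / (1 + t\<^sup>2)))"
    using has_bochner_integral_cpow_one_plus_square[of 1] unfolding * by (simp add: has_bochner_integral_iff)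
  thus ?thesis unfolding complex_of_real_integrable_eq .
qed

lemma continuous_on_Gamma_vertical:
  assumes "a > 0"
  shows "continuous_on UNIV (\<lambda>t. Gamma (Complex a t))"
proof (rule continuous_on_compose2[OF continuous_on_Gamma[of "{z. Re z > 0}"]])
  show "continuous_on UNIV (Complex a)"
    unfolding Complex_eq by (intro continuous_intros)
qed (use assms in \<open>auto elim!: nonpos_Ints_cases\<close>)

text \<open>
  Stirling's formula is not needed: \<open>\<Gamma>(z) = \<Gamma>(z + 2) / (z (z + 1))\<close> and
  \<open>\<bar>\<Gamma>(z + 2)\<bar> \<le> \<Gamma>(Re z + 2)\<close> give quadratic decay.
\<close>
lemma integrable_Gamma_vertical:
  assumes "a > 0"
  shows "integrable lborel (\<lambda>t. Gamma (Complex a t))"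
proof (rule Bochner_Integration.integrable_bound)
  \<comment> \<open>Chosen so that \<open>m * (1 + t\<^sup>2)\<close> is at most
    \<open>a\<^sup>2 + t\<^sup>2\<close>, the square of \<open>norm z\<close>.\<close>
  define m where "m = min 1 (a\<^sup>2)"
  have m: "m > 0" using assms by (simp add: m_def)
  show "integrable lborel (\<lambda>t::real. Gamma (a + 2) / m * (1 / (1 + t\<^sup>2)))"
    by (intro integrable_mult_right integrable_inverse_one_plus_square)
  show "(\<lambda>t. Gamma (Complex a t)) \<in> borel_measurable lborel"
    using borel_measurable_continuous_onI[OF continuous_on_Gamma_vertical[OF assms]] by simp
  show "AE t in lborel. norm (Gamma (Complex a t)) \<le> norm (Gamma (a + 2) / m * (1 / (1 + t\<^sup>2)))"
  proof (rule AE_I2)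
    fix t :: real
    define z where "z = Complex a t"
    have [simp]: "Re z = a" by (simp add: z_def)
    have z: "z \<notin> \<int>\<^sub>\<le>\<^sub>0" "z + 1 \<notin> \<int>\<^sub>\<le>\<^sub>0" "z \<noteq> 0" "z + 1 \<noteq> 0"
      using assms by (auto elim!: nonpos_Ints_cases simp: complex_eq_iff)
    have "Gamma (z + 2) = (z + 1) * (z * Gamma z)"
      using Gamma_plus1[OF z(1)] Gamma_plus1[OF z(2)] by (simp add: add.assoc)
    hence eq: "norm (z + 1) * norm z * norm (Gamma z) = norm (Gamma (z + 2))"
      by (simp add: norm_mult)
    also have "\<dots> \<le> Gamma (a + 2)"
      using norm_Gamma_le_Gamma_Re[of "z + 2"] assms by simp
    finally have *: "norm (z + 1) * norm z * norm (Gamma z) \<le> Gamma (a + 2)" .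
    have "m * (1 + t\<^sup>2) = m + m * t\<^sup>2" by (simp add: algebra_simps)
    also have "\<dots> \<le> a\<^sup>2 + 1 * t\<^sup>2"
      by (intro add_mono mult_right_mono) (auto simp: m_def)
    also have "\<dots> = norm z * norm z"
      by (simp add: z_def cmod_def)
    also have "\<dots> \<le> norm (z + 1) * norm z"
      using assms by (intro mult_right_mono) (auto simp: cmod_def z_def power_mono)
    finally have "m * (1 + t\<^sup>2) * norm (Gamma z) \<le> norm (z + 1) * norm z * norm (Gamma z)"
      by (rule mult_right_mono) auto
    with * have "m * (1 + t\<^sup>2) * norm (Gamma z) \<le> Gamma (a + 2)" by simp
    hence "norm (Gamma z) \<le> Gamma (a + 2) / (m * (1 + t\<^sup>2))"
      using m add_pos_nonneg[of 1 "t\<^sup>2"] by (simp add: pos_le_divide_eq mult_ac)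
    thus "norm (Gamma (Complex a t)) \<le> norm (Gamma (a + 2) / m * (1 / (1 + t\<^sup>2)))"
      using Gamma_real_pos[of "a + 2"] assms m by (simp add: z_def)
  qed
qed

section \<open>Fourier inversion and the Cahen-Mellin formula\<close>

text \<open>The characteristic function of the standard normal distribution at
  \<open>u / \<epsilon>\<close>, after rescaling the integration variable by
  \<open>\<epsilon>\<close>.\<close>

lemma has_bochner_integral_gaussian_fourier:
  fixes \<epsilon> u :: real
  assumes "\<epsilon> > 0"
  shows "has_bochner_integral lborel (\<lambda>t. iexp (t * u) * of_real (exp (- ((\<epsilon> * t)\<^sup>2 / 2))))
           (of_real (sqrt (2 * pi) / \<epsilon> * exp (- ((u / \<epsilon>)\<^sup>2 / 2))))"
proof -
  interpret prob_space std_normal_distribution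
    by (rule prob_space_normal_density) simp
  let ?s = "complex_of_real (sqrt (2 * pi))"
  define v where "v = u / \<epsilon>"
  have "integrable std_normal_distribution (\<lambda>x. iexp (v * x))"
    by (auto intro!: integrable_iexp)
  moreover have "(\<integral>x. iexp (v * x) \<partial>std_normal_distribution) = of_real (exp (- (v\<^sup>2) / 2))"
    using fun_cong[OF char_std_normal_distribution, of v] by (simp add: char_def)
  ultimately have "has_bochner_integral lborel (\<lambda>x. std_normal_density x *\<^sub>R iexp (v * x)) (of_real (exp (- (v\<^sup>2) / 2)))"
    by (simp add: has_bochner_integral_iff integrable_density integral_density)
  from has_bochner_integral_mult_right[OF this, of ?s]
  have "has_bochner_integral lborel (\<lambda>x. iexp (v * x) * of_real (exp (- (x\<^sup>2 / 2)))) (?s * of_real (exp (- (v\<^sup>2 / 2))))"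
    by (simp add: std_normal_density_def scaleR_conv_of_real mult_ac real_sqrt_mult)
  hence "has_bochner_integral lborel (\<lambda>t. iexp (v * (0 + \<epsilon> * t)) * of_real (exp (- ((0 + \<epsilon> * t)\<^sup>2 / 2))))
     ((?s * of_real (exp (- (v\<^sup>2 / 2)))) /\<^sub>R \<bar>\<epsilon>\<bar>)"
    using assms by (subst (asm) lborel_has_bochner_integral_real_affine_iff[of \<epsilon> _ _ 0]) auto
  moreover have "v * (0 + \<epsilon> * t) = t * u" for t
    using assms by (simp add: v_def)
  moreover have "(?s * of_real (exp (- (v\<^sup>2 / 2)))) /\<^sub>R \<bar>\<epsilon>\<bar> = of_real (sqrt (2 * pi) / \<epsilon> * exp (- ((u / \<epsilon>)\<^sup>2 / 2)))"
    using assms by (simp add: v_def scaleR_conv_of_real field_simps)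
  ultimately show ?thesis
    by (simp only: add_0)
qed

text \<open>Integrability of \<open>\<phi>\<close> dominates the regularized transform; the bound
  \<open>K\<close> dominates the Gaussian averages of \<open>f\<close>, and continuity identifies
  their limit.\<close>

lemma fourier_inversion:
  fixes f :: "real \<Rightarrow> complex"
  assumes int: "integrable lborel f" and cont: "continuous_on UNIV f" and bd: "\<And>x. norm (f x) \<le> K"
    and \<phi>: "\<And>t. has_bochner_integral lborel (\<lambda>y. f y * iexp (t * y)) (\<phi> t)"
    and int\<phi>: "integrable lborel \<phi>"
  shows "has_bochner_integral lborel (\<lambda>t. \<phi> t * iexp (- (t * x))) (2 * pi * f x)"
proof -
  have [measurable]: "f \<in> borel_measurable borel" "\<phi> \<in> borel_measurable borel"
    using int int\<phi> by (simp_all add: borel_measurable_integrable)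
  \<comment> \<open>Insert the factor \<open>exp (- (\<epsilon> t)\<^sup>2 / 2)\<close>, swap the integrals, and let \<open>\<epsilon>\<close> tend to \<open>0\<close> on both sides.\<close>
  define \<epsilon> :: "nat \<Rightarrow> real" where "\<epsilon> n = 1 / (real n + 1)" for n
  have \<epsilon>: "\<epsilon> n > 0" for n by (simp add: \<epsilon>_def)
  have \<epsilon>0: "\<epsilon> \<longlonglongrightarrow> 0"
    unfolding \<epsilon>_def using LIMSEQ_inverse_real_of_nat by (simp add: inverse_eq_divide add.commute)
  let ?F = "\<lambda>t. \<phi> t * iexp (- (t * x))"
  define g where "g n t = ?F t * of_real (exp (- ((\<epsilon> n * t)\<^sup>2 / 2)))" for n t
  \<comment> \<open>The regularized integral after the swap and the substitution
    \<open>y = x + \<epsilon> n * w\<close>: up to a constant, a Gaussian average of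
    \<open>f\<close> that concentrates at \<open>x\<close>.\<close>
  define b where "b n w = of_real (sqrt (2 * pi) * exp (- (w\<^sup>2 / 2))) * f (x + \<epsilon> n * w)" for n w
  have intF: "integrable lborel ?F"
    by (rule Bochner_Integration.integrable_bound[OF int\<phi>]) (auto simp: norm_mult)
  have lim_g: "(\<lambda>n. integral\<^sup>L lborel (g n)) \<longlonglongrightarrow> integral\<^sup>L lborel ?F"
  proof (rule integral_dominated_convergence)
    show "integrable lborel (\<lambda>t. norm (\<phi> t))" using int\<phi> by simp
    show "AE t in lborel. (\<lambda>n. g n t) \<longlonglongrightarrow> ?F t"
    proof (rule AE_I2)
      fix t
      have "(\<lambda>n. ?F t * of_real (exp (- ((\<epsilon> n * t)\<^sup>2 / 2)))) \<longlonglongrightarrow> ?F t * of_real (exp (- ((0 * t)\<^sup>2 / 2)))"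
        by (intro tendsto_intros \<epsilon>0) auto
      thus "(\<lambda>n. g n t) \<longlonglongrightarrow> ?F t" by (simp add: g_def)
    qed
    show "AE t in lborel. norm (g n t) \<le> norm (\<phi> t)" for n
      by (intro AE_I2) (auto simp: g_def norm_mult intro!: mult_left_le)
    show "g n \<in> borel_measurable lborel" for n
      unfolding g_def by measurable
  qed measurable
  have gauss: "integrable lborel (\<lambda>w::real. exp (- (w\<^sup>2 / 2)))" 
      "(\<integral>w. exp (- (w\<^sup>2 / 2)) \<partial>lborel) = sqrt (2 * pi)"
    using has_bochner_integral_gaussian[of "1/2"] by (simp_all add: has_bochner_integral_iff mult.commute)
  have lim_b: "(\<lambda>n. integral\<^sup>L lborel (b n)) \<longlonglongrightarrow>
      (\<integral>w. of_real (sqrt (2 * pi) * exp (- (w\<^sup>2 / 2))) * f x \<partial>lborel)"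
  proof (rule integral_dominated_convergence)
    show "integrable lborel (\<lambda>w. sqrt (2 * pi) * K * exp (- (w\<^sup>2 / 2)))"
      using gauss by (intro integrable_mult_right)
    show "AE w in lborel. (\<lambda>n. b n w) \<longlonglongrightarrow> of_real (sqrt (2 * pi) * exp (- (w\<^sup>2 / 2))) * f x"
    proof (rule AE_I2)
      fix w
      have "(\<lambda>n. x + \<epsilon> n * w) \<longlonglongrightarrow> x + 0 * w"
        by (intro tendsto_intros \<epsilon>0)
      moreover have "isCont f x"
        using cont by (simp add: continuous_on_eq_continuous_at)
      ultimately have "(\<lambda>n. f (x + \<epsilon> n * w)) \<longlonglongrightarrow> f x"
        using isCont_tendsto_compose[of x f "\<lambda>n. x + \<epsilon> n * w"] by simp
      thus "(\<lambda>n. b n w) \<longlonglongrightarrow> of_real (sqrt (2 * pi) * exp (- (w\<^sup>2 / 2))) * f x"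
        unfolding b_def by (intro tendsto_intros)
    qed
    show "AE w in lborel. norm (b n w) \<le> sqrt (2 * pi) * K * exp (- (w\<^sup>2 / 2))" for n
      by (intro AE_I2) (auto simp: b_def norm_mult bd mult_ac intro!: mult_left_mono)
    show "b n \<in> borel_measurable lborel" for n
      unfolding b_def by measurable
  qed measurable
  have gb: "integral\<^sup>L lborel (g n) = integral\<^sup>L lborel (b n)" for n
  proof -
    define B where "B y = f y * of_real (sqrt (2 * pi) / \<epsilon> n * exp (- (((y - x) / \<epsilon> n)\<^sup>2 / 2)))" for y
    define c where "c = complex_of_real (sqrt (2 * pi) / \<epsilon> n)"
    have gauss': "has_bochner_integral lborel (\<lambda>t. complex_of_real (exp (- ((\<epsilon> n * t)\<^sup>2 / 2)))) c"
      using has_bochner_integral_gaussian_fourier[OF \<epsilon>[of n], of 0] by (simp add: c_def)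
    have intB: "integrable lborel B"
    proof (rule Bochner_Integration.integrable_bound)
      show "integrable lborel (\<lambda>y. c * f y)" using int by simp
      show "AE y in lborel. norm (B y) \<le> norm (c * f y)"
      proof (rule AE_I2)
        fix y
        have "norm (B y) = norm (c * f y) * exp (- (((y - x) / \<epsilon> n)\<^sup>2 / 2))"
          by (simp add: B_def c_def norm_mult norm_divide mult_ac)
        also have "\<dots> \<le> norm (c * f y)"
          by (intro mult_left_le) auto
        finally show "norm (B y) \<le> norm (c * f y)" .
      qed
    qed (auto simp: B_def[abs_def])
    have "has_bochner_integral lborel (g n) (integral\<^sup>L lborel B)"
    proof (rule Fubini_has_bochner_integral_lborel)
      let ?h = "\<lambda>t y. f y * iexp (t * y) * (iexp (- (t * x)) * of_real (exp (- ((\<epsilon> n * t)\<^sup>2 / 2))))"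
      show "(\<lambda>(t, y). ?h t y) \<in> borel_measurable (lborel \<Otimes>\<^sub>M lborel)" by measurable
      show "g n \<in> borel_measurable lborel" unfolding g_def by measurable
      show "AE t in lborel. has_bochner_integral lborel (?h t) (g n t)"
        unfolding g_def mult.assoc[of "\<phi> _"]
        by (intro AE_I2 has_bochner_integral_mult_left \<phi>)
      show "AE y in lborel. has_bochner_integral lborel (\<lambda>t. ?h t y) (B y)"
      proof (rule AE_I2)
        fix y
        have "?h t y = f y * (iexp (t * (y - x)) * of_real (exp (- ((\<epsilon> n * t)\<^sup>2 / 2))))" for t
        proof -
          have "iexp (t * (y - x)) = iexp (t * y) * iexp (- (t * x))"
            by (simp add: right_diff_distrib flip: exp_add)
          thus ?thesis by (simp only: mult_ac)
        qed
        thus "has_bochner_integral lborel (\<lambda>t. ?h t y) (B y)"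
          unfolding B_def using \<epsilon>[of n]
          by (simp only:) (intro has_bochner_integral_mult_right has_bochner_integral_gaussian_fourier)
      qed
      show "AE y in lborel. has_bochner_integral lborel (\<lambda>t. complex_of_real (norm (?h t y))) (of_real (norm (f y)) * c)"
        using gauss' by (intro AE_I2) (simp add: norm_mult has_bochner_integral_mult_right)
      show "integrable lborel (\<lambda>y. complex_of_real (norm (f y)) * c)"
        using int by (intro integrable_mult_left) (simp add: complex_of_real_integrable_eq)
      show "has_bochner_integral lborel B (integral\<^sup>L lborel B)"
        using intB by (rule has_bochner_integral_integrable)
    qed
    hence "integral\<^sup>L lborel (g n) = integral\<^sup>L lborel B"
      by (simp add: has_bochner_integral_iff)
    also have "\<dots> = \<bar>\<epsilon> n\<bar> *\<^sub>R (\<integral>w. B (x + \<epsilon> n * w) \<partial>lborel)"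
      using \<epsilon>[of n] by (intro lborel_integral_real_affine) auto
    also have "\<dots> = (\<integral>w. \<bar>\<epsilon> n\<bar> *\<^sub>R B (x + \<epsilon> n * w) \<partial>lborel)"
      by simp
    also have "(\<lambda>w. \<bar>\<epsilon> n\<bar> *\<^sub>R B (x + \<epsilon> n * w)) = b n"
      using \<epsilon>[of n] by (auto simp: B_def b_def fun_eq_iff scaleR_conv_of_real)
    finally show ?thesis .
  qed
  have "integral\<^sup>L lborel ?F = (\<integral>w. of_real (sqrt (2 * pi) * exp (- (w\<^sup>2 / 2))) * f x \<partial>lborel)"
    using LIMSEQ_unique[OF lim_g] lim_b unfolding gb by blast
  also have "\<dots> = of_real (sqrt (2 * pi) * (\<integral>w. exp (- (w\<^sup>2 / 2)) \<partial>lborel)) * f x"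
    using gauss(1) by simp
  also have "\<dots> = 2 * pi * f x"
    unfolding gauss(2) by simp
  finally show ?thesis using intF by (simp add: has_bochner_integral_iff)
qed

text \<open>Euler's integral shows that \<open>Gamma (Complex a t)\<close> is the Fourier transform
  of \<open>exp (a * x - exp x)\<close>. Inversion at \<open>ln y\<close> and multiplication by
  \<open>cpow y (- of_real a)\<close> give the formula.\<close>

lemma has_bochner_integral_cahen_mellin:
  fixes a y :: real
  assumes "a > 0" "y > 0"
  shows "has_bochner_integral lborel (\<lambda>t. Gamma (Complex a t) * cpow y (- Complex a t)) (of_real (2 * pi * exp (- y)))"
proof -
  define f where "f x = exp (of_real a * of_real x) * complex_of_real (exp (- exp x))" for x :: real
  have "has_bochner_integral lborel (\<lambda>t. Gamma (Complex a t) * iexp (- (t * ln y))) (2 * pi * f (ln y))"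
  proof (rule fourier_inversion)
    show "integrable lborel f"
      using has_bochner_integral_Gamma_exp[of "of_real a"] assms(1)
      unfolding f_def by (simp add: has_bochner_integral_iff)
    show "continuous_on UNIV f" unfolding f_def by (intro continuous_intros)
    show "integrable lborel (\<lambda>t. Gamma (Complex a t))"
      using assms(1) by (rule integrable_Gamma_vertical)
    show "has_bochner_integral lborel (\<lambda>x. f x * iexp (t * x)) (Gamma (Complex a t))" for t
    proof -
      have "f x * iexp (t * x) = exp (Complex a t * of_real x) * of_real (exp (- exp x))" for x
        by (simp add: f_def Complex_eq ring_distribs exp_add mult_ac)
      thus ?thesis using has_bochner_integral_Gamma_exp[of "Complex a t"] assms(1) by simp
    qed
    \<comment> \<open>The exponent \<open>a * x - exp x\<close> is largest at
      \<open>x = ln a\<close>, by the tangent inequality for \<open>exp\<close>.\<close>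
    show "norm (f x) \<le> exp (a * ln a - a)" for x
    proof -
      have "1 + (x - ln a) \<le> exp (x - ln a)" by (rule exp_ge_add_one_self)
      hence "a * (1 + (x - ln a)) \<le> exp x"
        using assms(1) by (simp add: exp_diff field_simps)
      hence "a * x + - exp x \<le> a * ln a - a" by (simp add: algebra_simps)
      hence "exp (a * x + - exp x) \<le> exp (a * ln a - a)" by (subst exp_le_cancel_iff)
      thus ?thesis unfolding exp_add by (simp add: f_def norm_mult)
    qed
  qed
  from has_bochner_integral_mult_left[OF this, of "cpow y (- of_real a)"]
  have "has_bochner_integral lborel (\<lambda>t. Gamma (Complex a t) * (iexp (- (t * ln y)) * cpow y (- of_real a)))
     (2 * pi * (f (ln y) * cpow y (- of_real a)))"
    by (simp add: mult.assoc)
  moreover have "iexp (- (t * ln y)) * cpow y (- of_real a) = cpow y (- Complex a t)" for t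
    by (simp add: cpow_def Complex_eq ring_distribs mult_ac flip: exp_add)
  moreover have "f (ln y) * cpow y (- of_real a) = of_real (exp (- y))"
    using assms(2) by (simp add: f_def cpow_def exp_minus)
  ultimately show ?thesis by simp
qed

lemma cpow_powr: "w > 0 \<Longrightarrow> cpow (w powr a) z = cpow w (of_real a * z)"
  by (simp add: cpow_def ln_powr mult_ac)

text \<open>Cahen-Mellin at \<open>w powr \<alpha>\<close> on the line with real part
  \<open>(1 + 2 * c) / \<alpha>\<close>, with the integration variable rescaled by
  \<open>2 / \<alpha>\<close> to produce the Gamma factor of \<open>theta\<close>.\<close>

lemma has_bochner_integral_mellin_exp_powr:
  fixes \<alpha> c w :: real
  assumes "\<alpha> > 0" "c > -1/2" "w > 0"
  shows "has_bochner_integral lborel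
     (\<lambda>t. Gamma (of_real (1 / \<alpha>) + 2 * Complex c t / of_real \<alpha>) * cpow w (- (2 * (1/2 + Complex c t))))
     (of_real (pi * \<alpha> * exp (- (w powr \<alpha>))))"
proof -
  define a where "a = (1 + 2 * c) / \<alpha>"
  have a: "a > 0" using assms by (simp add: a_def)
  have "has_bochner_integral lborel
     (\<lambda>t. Gamma (Complex a (0 + 2 / \<alpha> * t)) * cpow (w powr \<alpha>) (- Complex a (0 + 2 / \<alpha> * t)))
     (of_real (2 * pi * exp (- (w powr \<alpha>))) /\<^sub>R \<bar>2 / \<alpha>\<bar>)"
    using has_bochner_integral_cahen_mellin[OF a, of "w powr \<alpha>"] assms
      lborel_has_bochner_integral_real_affine_iff[of "2/\<alpha>"
        "\<lambda>t. Gamma (Complex a t) * cpow (w powr \<alpha>) (- Complex a t)"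
        "of_real (2 * pi * exp (- (w powr \<alpha>)))" 0]
    by simp
  moreover have "Gamma (Complex a (0 + 2 / \<alpha> * t)) * cpow (w powr \<alpha>) (- Complex a (0 + 2 / \<alpha> * t)) =
      Gamma (of_real (1 / \<alpha>) + 2 * Complex c t / of_real \<alpha>) * cpow w (- (2 * (1/2 + Complex c t)))" for t
  proof -
    have "Complex a (0 + 2 / \<alpha> * t) = of_real (1 / \<alpha>) + 2 * Complex c t / of_real \<alpha>"
      using assms by (simp add: a_def complex_eq_iff add_divide_distrib)
    moreover have "of_real \<alpha> * - Complex a (0 + 2 / \<alpha> * t) = - (2 * (1/2 + Complex c t))"
      using assms by (simp add: a_def complex_eq_iff)
    ultimately show ?thesis using assms by (simp only: cpow_powr)
  qed
  moreover have "of_real (2 * pi * exp (- (w powr \<alpha>))) /\<^sub>R \<bar>2 / \<alpha>\<bar> = complex_of_real (pi * \<alpha> * exp (- (w powr \<alpha>)))"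
    using assms by (simp add: scaleR_conv_of_real)
  ultimately show ?thesis by (simp only:)
qed

section \<open>The convolution as a double Mellin-Barnes integral\<close>

lemma has_bochner_integral_pair_mult:
  fixes f g :: "real \<Rightarrow> complex"
  assumes "has_bochner_integral lborel f a" "has_bochner_integral lborel g b"
  shows "has_bochner_integral lborel (\<lambda>(t, v). f t * g v) (a * b)"
proof -
  have [measurable]: "f \<in> borel_measurable borel" "g \<in> borel_measurable borel"
    using assms by (auto simp: has_bochner_integral_iff dest: borel_measurable_integrable)
  have int: "integrable (lborel \<Otimes>\<^sub>M lborel) (\<lambda>(t, v). f t * g v)"
    by (rule lborel_pair.Fubini_integrable)
       (use assms in \<open>auto simp: has_bochner_integral_iff norm_mult\<close>)
  moreover have "integral\<^sup>L (lborel \<Otimes>\<^sub>M lborel) (\<lambda>(t, v). f t * g v) = a * b"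
    using lborel_pair.integral_fst'[OF int] assms by (simp add: has_bochner_integral_iff)
  ultimately show ?thesis by (simp add: has_bochner_integral_iff lborel_prod)
qed

text \<open>Gamma has no poles in the open right half-plane, hence is continuous there.\<close>

lemma Gamma_positive_Re_measurable:
  fixes g :: "'a \<Rightarrow> complex"
  assumes g: "g \<in> borel_measurable M" and "\<And>x. x \<in> space M \<Longrightarrow> Re (g x) > 0"
  shows "(\<lambda>x. Gamma (g x)) \<in> borel_measurable M"
proof -
  let ?S = "{z::complex. Re z > 0}"
  have "continuous_on ?S (Gamma :: complex \<Rightarrow> complex)"
    by (rule continuous_on_Gamma) (auto elim!: nonpos_Ints_cases)
  hence "Gamma \<in> borel_measurable (restrict_space borel ?S)"
    by (rule borel_measurable_continuous_on_restrict)
  moreover have "g \<in> measurable M (restrict_space borel ?S)"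
    using assms by (intro measurable_restrict_space2) auto
  ultimately show ?thesis by (rule measurable_compose[rotated])
qed

lemma rGamma_measurable [measurable]: "(rGamma :: complex \<Rightarrow> complex) \<in> borel_measurable borel"
  by (intro borel_measurable_continuous_onI continuous_on_rGamma)

lemma Complex_measurable [measurable (raw)]:
  assumes [measurable]: "f \<in> borel_measurable M" "g \<in> borel_measurable M"
  shows "(\<lambda>x. Complex (f x) (g x)) \<in> borel_measurable M"
  unfolding Complex_eq by measurable

lemma has_bochner_integral_exp_powr_convolution:
  fixes \<alpha> \<beta> c1 c2 d L1 L2 :: real
  assumes \<alpha>: "\<alpha> > 0" and \<beta>: "\<beta> > 0" and L: "L1 > 0" "L2 > 0" and d: "d \<noteq> 0"
    and adm: "admissible_contour c1 c2"
  shows "has_bochner_integral lborel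
     (\<lambda>x. of_real (pi * \<alpha> * exp (- ((L1 * \<bar>d - x\<bar>) powr \<alpha>))) * of_real (pi * \<beta> * exp (- ((L2 * \<bar>x\<bar>) powr \<beta>))))
     (complex_of_real (sqrt pi / (L1 * L2 * \<bar>d\<bar>)) *
       (\<integral>(t, v). G0_kernel \<alpha> \<beta> (1 / (L1 * d)\<^sup>2) (1 / (L2 * d)\<^sup>2) (Complex c1 t) (Complex c2 v) \<partial>lborel))"
proof -
  have c: "-1/2 < c1" "c1 < 0" "-1/2 < c2" "c2 < 0" "-1/2 < c1 + c2"
    using adm by (auto simp: admissible_contour_def)
  \<comment> \<open>The integrand splits into the factors \<open>T\<close>, free of
    \<open>x\<close>, and \<open>E\<close>, which carries \<open>x\<close>. \<open>R\<close> is the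
    \<open>x\<close>-integral of \<open>E\<close>: Riesz' formula with \<open>A = 1/2 + u\<close>
    and \<open>B = 1/2 + s\<close>.\<close>
  define T where "T \<alpha> s = Gamma (of_real (1 / \<alpha>) + 2 * s / of_real \<alpha>)" for \<alpha> :: real and s :: complex
  define E where "E s u x = cpow (L1 * \<bar>d - x\<bar>) (- (2 * (1/2 + s))) * cpow (L2 * \<bar>x\<bar>) (- (2 * (1/2 + u)))"
    for s u x
  define R where "R s u = cpow L1 (- (2 * (1/2 + s))) * cpow L2 (- (2 * (1/2 + u))) *
     (of_real (sqrt pi) * Gamma (- u) * Gamma (- s) * Gamma (1/2 + s + u)
              * rGamma (1/2 + u) * rGamma (1/2 + s) * rGamma (- s - u) * cpow \<bar>d\<bar> (- 1 - 2 * s - 2 * u))" for s u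
  define K where "K s u = complex_of_real (sqrt pi / (L1 * L2 * \<bar>d\<bar>)) *
       G0_kernel \<alpha> \<beta> (1 / (L1 * d)\<^sup>2) (1 / (L2 * d)\<^sup>2) s u" for s u
  have posT: "Re (of_real (1 / a) + 2 * Complex b t / of_real a) > 0" if "a > 0" "b > - 1/2" for a b t :: real
  proof -
    have "Re (of_real (1 / a) + 2 * Complex b t / of_real a) = (1 + 2 * b) / a"
      using that(1) by (simp add: field_simps)
    thus ?thesis using that by simp
  qed
  have riesz: "has_bochner_integral lborel (E s u) (R s u)"
    if "Re s < 0" "Re u < 0" "Re s + Re u > -1/2" for s u
  proof -
    have "has_bochner_integral lborel (\<lambda>x. cpow L1 (- (2 * (1/2 + s))) * cpow L2 (- (2 * (1/2 + u))) *
       (cpow \<bar>x\<bar> (- (2 * (1/2 + u))) * cpow \<bar>d - x\<bar> (- (2 * (1/2 + s))))) (R s u)"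
    proof -
      have *: "1/2 - (1/2 + u) = - u" "1/2 - (1/2 + s) = - s" "1/2 + u + (1/2 + s) - 1/2 = 1/2 + s + u"
        "1 - (1/2 + u) - (1/2 + s) = - s - u" "1 - 2 * (1/2 + u) - 2 * (1/2 + s) = - 1 - 2 * s - 2 * u"
        by (simp_all add: algebra_simps)
      show ?thesis
        unfolding R_def using has_bochner_integral_riesz[of "1/2 + u" "1/2 + s" d, unfolded *] that d
        by (intro has_bochner_integral_mult_right) simp
    qed
    moreover have "AE x in lborel. cpow L1 (- (2 * (1/2 + s))) * cpow L2 (- (2 * (1/2 + u))) *
       (cpow \<bar>x\<bar> (- (2 * (1/2 + u))) * cpow \<bar>d - x\<bar> (- (2 * (1/2 + s)))) = E s u x"
      using AE_lborel_singleton[of "0::real"] AE_lborel_singleton[of d]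
      by eventually_elim (use L in \<open>simp add: E_def cpow_mult mult_ac\<close>)
    ultimately show ?thesis
      by (subst (asm) has_bochner_integral_cong_AE) (auto simp: E_def[abs_def])
  qed
  \<comment> \<open>The exponents \<open>-1 - 2*s\<close> and \<open>-1 - 2*u\<close> at
    \<open>L1\<close> and \<open>L2\<close>, and \<open>-1 - 2*s - 2*u\<close> at the modulus of
    \<open>d\<close>, each contain a \<open>-1\<close>; these three give the prefactor, the rest
    gives the powers in the kernel.\<close>
  have RK: "T \<alpha> s * T \<beta> u * R s u = K s u" for s u
  proof -
    have dp: "\<bar>d\<bar> > 0" using d by simp
    have p1: "cpow (1 / (l * d)\<^sup>2) s = cpow l (- (2 * s)) * cpow \<bar>d\<bar> (- (2 * s))" if "l > 0" for l s
    proof -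
      have "cpow (1 / (l * d)\<^sup>2) s = cpow ((l * d)\<^sup>2) (- s)"
        using that d by (subst cpow_divide) (auto simp: cpow_def)
      also have "\<dots> = cpow (l * \<bar>d\<bar>) (- (2 * s))"
        using that by (simp add: cpow_square abs_mult)
      finally show ?thesis using that dp by (simp add: cpow_mult)
    qed
    have p2: "cpow l (- (2 * (1/2 + s))) = cpow l (- (2 * s)) / of_real l" if "l > 0" for l s
    proof -
      have "- (2 * (1/2 + s)) = - (2 * s) + - 1" by (simp add: algebra_simps)
      moreover have "cpow l (- 1) = 1 / of_real l"
        using that cpow_minus[of l 1] by (simp add: cpow_def[of l 1] exp_of_real)
      ultimately show ?thesis using cpow_add[of l "- (2 * s)" "- 1"] by (simp only: times_divide_eq_right mult_1_right)
    qed
    have p3: "cpow \<bar>d\<bar> (- 1 - 2 * s - 2 * u) = cpow \<bar>d\<bar> (- (2 * s)) * cpow \<bar>d\<bar> (- (2 * u)) / of_real \<bar>d\<bar>"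
    proof -
      have "- 1 - 2 * s - 2 * u = - (2 * s) + - (2 * (1/2 + u))" by (simp add: algebra_simps)
      thus ?thesis using cpow_add[of "\<bar>d\<bar>" "- (2 * s)" "- (2 * (1/2 + u))"] p2[OF dp]
        by (simp only: times_divide_eq_right)
    qed
    have "complex_of_real (1 / (L1 * d)\<^sup>2) powr s = cpow (1 / (L1 * d)\<^sup>2) s"
         "complex_of_real (1 / (L2 * d)\<^sup>2) powr u = cpow (1 / (L2 * d)\<^sup>2) u"
      using L d by (intro powr_eq_cpow; simp)+
    hence "K s u = complex_of_real (sqrt pi / (L1 * L2 * \<bar>d\<bar>)) *
       (Gamma (1/2 + s + u) * rGamma (- s - u) * theta \<alpha> s * theta \<beta> u *
        (cpow L1 (- (2 * s)) * cpow \<bar>d\<bar> (- (2 * s))) * (cpow L2 (- (2 * u)) * cpow \<bar>d\<bar> (- (2 * u))))"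
      unfolding K_def G0_kernel_def using p1[OF L(1)] p1[OF L(2)] by simp
    thus ?thesis
      unfolding R_def p2[OF L(1)] p2[OF L(2)] p3 theta_def T_def by (simp add: mult_ac)
  qed
  have intT: "integrable lborel (\<lambda>t. T a (Complex b t))" if "a > 0" "b > - 1/2" for a b :: real
  proof -
    \<comment> \<open>At \<open>w = 1\<close> the power in the Mellin formula is 1, leaving the
      Gamma factor alone.\<close>
    have "has_bochner_integral lborel (\<lambda>t. T a (Complex b t) * cpow 1 (- (2 * (1/2 + Complex b t))))
     (of_real (pi * a * exp (- (1 powr a))))"
      unfolding T_def by (rule has_bochner_integral_mellin_exp_powr) (use that in auto)
    thus ?thesis by (simp add: has_bochner_integral_iff cpow_def)
  qed
  let ?h = "\<lambda>x (t, v). T \<alpha> (Complex c1 t) * T \<beta> (Complex c2 v) * E (Complex c1 t) (Complex c2 v) x"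
  let ?A = "\<lambda>x. of_real (pi * \<alpha> * exp (- ((L1 * \<bar>d - x\<bar>) powr \<alpha>))) * complex_of_real (pi * \<beta> * exp (- ((L2 * \<bar>x\<bar>) powr \<beta>)))"
  let ?B = "\<lambda>(t, v). K (Complex c1 t) (Complex c2 v)"
  \<comment> \<open>The norm of \<open>E\<close> depends on the real parts \<open>c1\<close> and
    \<open>c2\<close> alone, so \<open>R\<close> is constant here and \<open>?N\<close> is a product
    of functions of one variable.\<close>
  let ?N = "\<lambda>(t, v). complex_of_real (norm (T \<alpha> (Complex c1 t))) * complex_of_real (norm (T \<beta> (Complex c2 v))) * R (of_real c1) (of_real c2)"
  have [measurable]: "(\<lambda>t. T \<alpha> (Complex c1 t)) \<in> borel_measurable borel" "(\<lambda>t. T \<beta> (Complex c2 t)) \<in> borel_measurable borel"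
    using intT \<alpha> \<beta> c by (auto dest!: borel_measurable_integrable)
  have hB: "has_bochner_integral lborel (\<lambda>x. ?h x tv) (?B tv)" for tv
  proof (cases tv)
    case (Pair t v)
    thus ?thesis using has_bochner_integral_mult_right[OF riesz[of "Complex c1 t" "Complex c2 v"]] c
      by (simp flip: RK)
  qed
  have hN: "has_bochner_integral lborel (\<lambda>x. complex_of_real (norm (?h x tv))) (?N tv)" for tv
  proof (cases tv)
    case (Pair t v)
    have "complex_of_real (norm (E (Complex c1 t) (Complex c2 v) x)) = E (of_real c1) (of_real c2) x" for x
      by (simp add: E_def norm_mult norm_cpow)
    thus ?thesis using Pair has_bochner_integral_mult_right[OF riesz[of "of_real c1" "of_real c2"]] c
      by (simp add: norm_mult)
  qed
  have intN: "integrable lborel ?N"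
  proof -
    have "integrable lborel (\<lambda>t. complex_of_real (norm (T \<alpha> (Complex c1 t))))"
         "integrable lborel (\<lambda>t. complex_of_real (norm (T \<beta> (Complex c2 t))))"
      using intT \<alpha> \<beta> c by (simp_all add: complex_of_real_integrable_eq)
    hence "integrable lborel (\<lambda>(t, v). complex_of_real (norm (T \<alpha> (Complex c1 t))) * complex_of_real (norm (T \<beta> (Complex c2 v))))"
      using has_bochner_integral_pair_mult by (blast dest: has_bochner_integral_integrable integrable.intros)
    from integrable_mult_left[OF this] show ?thesis by (simp add: case_prod_unfold)
  qed
  have measB: "?B \<in> borel_measurable lborel"
  proof -
    have [measurable]: "(\<lambda>v. Gamma (- Complex c1 v)) \<in> borel_measurable borel"
         "(\<lambda>v. Gamma (- Complex c2 v)) \<in> borel_measurable borel"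
         "(\<lambda>p. Gamma (1/2 + Complex c1 (fst p) + Complex c2 (snd p))) \<in> borel_measurable (borel \<Otimes>\<^sub>M borel)"
      using c by (intro Gamma_positive_Re_measurable; simp)+
    have cp: "(\<lambda>p. cpow l (f p)) \<in> borel_measurable (borel \<Otimes>\<^sub>M borel)"
      if [measurable]: "f \<in> borel_measurable (borel \<Otimes>\<^sub>M borel)" for l and f :: "real \<times> real \<Rightarrow> complex"
      unfolding cpow_def by measurable
    \<comment> \<open>In this form of the kernel, the remaining Gamma arguments have positive real
      part on an admissible contour.\<close>
    have "(\<lambda>p. T \<alpha> (Complex c1 (fst p)) * T \<beta> (Complex c2 (snd p)) * R (Complex c1 (fst p)) (Complex c2 (snd p)))
        \<in> borel_measurable (borel \<Otimes>\<^sub>M borel)"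
      unfolding R_def using cp by measurable
    thus ?thesis by (simp add: RK case_prod_unfold borel_prod)
  qed
  have intB: "integrable lborel ?B"
  proof (rule Bochner_Integration.integrable_bound[OF intN measB], rule AE_I2)
    fix tv
    have "?N tv = of_real (\<integral>x. norm (?h x tv) \<partial>lborel)"
      using hN[of tv] by (simp add: has_bochner_integral_iff)
    moreover have "norm (\<integral>x. ?h x tv \<partial>lborel) \<le> (\<integral>x. norm (?h x tv) \<partial>lborel)"
      by (rule integral_norm_bound)
    moreover have "(\<integral>x. ?h x tv \<partial>lborel) = ?B tv"
      using hB[of tv] by (simp add: has_bochner_integral_iff)
    ultimately show "norm (?B tv) \<le> norm (?N tv)" by simp
  qed
  have "has_bochner_integral lborel ?A (integral\<^sup>L lborel ?B)"
  proof (rule Fubini_has_bochner_integral_lborel)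
    have [measurable]: "(\<lambda>p. E (Complex c1 (fst (snd p))) (Complex c2 (snd (snd p))) (fst p)) \<in> borel_measurable (borel \<Otimes>\<^sub>M (borel \<Otimes>\<^sub>M borel))"
      unfolding E_def cpow_def by measurable
    have "(\<lambda>p. T \<alpha> (Complex c1 (fst (snd p))) * T \<beta> (Complex c2 (snd (snd p))) * E (Complex c1 (fst (snd p))) (Complex c2 (snd (snd p))) (fst p))
       \<in> borel_measurable (borel \<Otimes>\<^sub>M (borel \<Otimes>\<^sub>M borel))"
      by measurable
    thus "(\<lambda>(x, tv). ?h x tv) \<in> borel_measurable (lborel \<Otimes>\<^sub>M lborel)"
      by (simp add: case_prod_unfold borel_prod lborel_prod)
    show "?A \<in> borel_measurable lborel" by measurable
    show "AE x in lborel. has_bochner_integral lborel (?h x) (?A x)"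
      \<comment> \<open>At \<open>x = 0\<close> and \<open>x = d\<close> a base is zero and the
        Mellin formula does not apply.\<close>
      using AE_lborel_singleton[of "0::real"] AE_lborel_singleton[of d]
    proof eventually_elim
      case (elim x)
      have "has_bochner_integral lborel (\<lambda>(t, v). 
          (Gamma (of_real (1 / \<alpha>) + 2 * Complex c1 t / of_real \<alpha>) * cpow (L1 * \<bar>d - x\<bar>) (- (2 * (1/2 + Complex c1 t)))) *
          (Gamma (of_real (1 / \<beta>) + 2 * Complex c2 v / of_real \<beta>) * cpow (L2 * \<bar>x\<bar>) (- (2 * (1/2 + Complex c2 v))))) (?A x)"
        using elim L c \<alpha> \<beta>
        by (intro has_bochner_integral_pair_mult has_bochner_integral_mellin_exp_powr) auto
      thus ?case by (simp add: E_def T_def mult_ac)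
    qed
    show "AE tv in lborel. has_bochner_integral lborel (\<lambda>x. ?h x tv) (?B tv)"
      using hB by blast
    show "AE tv in lborel. has_bochner_integral lborel (\<lambda>x. complex_of_real (norm (?h x tv))) (?N tv)"
      using hN by blast
    show "has_bochner_integral lborel ?B (integral\<^sup>L lborel ?B)"
      using intB by (rule has_bochner_integral_integrable)
    show "integrable lborel ?N" by (rule intN)
  qed
  thus ?thesis by (simp add: K_def case_prod_unfold)
qed

section \<open>Generalized Gaussian densities and their convolution\<close>

lemma ggd_Lambda_pos:
  assumes "\<sigma> > 0" "\<alpha> > 0"
  shows "ggd_Lambda \<sigma> \<alpha> > 0"
  using assms by (auto simp: ggd_Lambda_def intro!: divide_pos_pos Gamma_real_pos)

lemma ggd_density_nonneg:
  assumes "\<sigma> > 0" "\<alpha> > 0"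
  shows "ggd_density \<mu> \<sigma> \<alpha> x \<ge> 0"
  using ggd_Lambda_pos[OF assms] Gamma_real_pos[of "1 / \<alpha>"] assms by (simp add: ggd_density_def)

lemma ggd_density_measurable [measurable]: "ggd_density \<mu> \<sigma> \<alpha> \<in> borel_measurable borel"
  unfolding ggd_density_def by measurable

text \<open>The factor with \<open>pi * \<alpha>\<close> is isolated because it is the exact value
  of the Mellin-Barnes integral of the exponential.\<close>

lemma ggd_density_eq:
  assumes "\<sigma> > 0" "\<alpha> > 0"
  shows "ggd_density \<mu> \<sigma> \<alpha> x = ggd_Lambda \<sigma> \<alpha> / (2 * pi * Gamma (1 / \<alpha>)) *
           (pi * \<alpha> * exp (- ((ggd_Lambda \<sigma> \<alpha> * \<bar>x - \<mu>\<bar>) powr \<alpha>)))"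
  using ggd_Lambda_pos[OF assms] by (simp add: ggd_density_def powr_mult)

text \<open>Identifies the arguments of \<open>G0\<close> in the theorem with those produced by
  Riesz' formula.\<close>

lemma ggd_scale:
  assumes "\<sigma> > 0" "\<alpha> > 0"
  shows "\<sigma>\<^sup>2 * Gamma (1 / \<alpha>) / (Gamma (3 / \<alpha>) * d\<^sup>2) = 1 / (ggd_Lambda \<sigma> \<alpha> * d)\<^sup>2"
  using assms Gamma_real_pos[of "1 / \<alpha>"] Gamma_real_pos[of "3 / \<alpha>"]
  by (simp add: ggd_Lambda_def power_mult_distrib power_divide field_simps)

text \<open>A shift by \<open>\<mu>2\<close> leaves centred exponentials convolved at
  \<open>d\<close>. In the constants \<open>L1 * L2\<close> cancels, and the two factors
  \<open>1 / (2 * pi)\<close> from the densities become the normalization of the double contour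
  integral.\<close>

lemma has_bochner_integral_ggd_convolution:
  assumes pos: "\<alpha> > 0" "\<beta> > 0" "\<sigma>1 > 0" "\<sigma>2 > 0"
    and adm: "admissible_contour c1 c2" and z: "z \<noteq> \<mu>1 + \<mu>2"
  shows "has_bochner_integral lborel
           (\<lambda>y. complex_of_real (ggd_density \<mu>1 \<sigma>1 \<alpha> (z - y) * ggd_density \<mu>2 \<sigma>2 \<beta> y))
           (complex_of_real (sqrt pi / (Gamma (1 / \<alpha>) * Gamma (1 / \<beta>) * \<bar>z - (\<mu>1 + \<mu>2)\<bar>))
                   * G0 \<alpha> \<beta> c1 c2
                       (\<sigma>1\<^sup>2 * Gamma (1 / \<alpha>) / (Gamma (3 / \<alpha>) * (z - (\<mu>1 + \<mu>2))\<^sup>2))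
                       (\<sigma>2\<^sup>2 * Gamma (1 / \<beta>) / (Gamma (3 / \<beta>) * (z - (\<mu>1 + \<mu>2))\<^sup>2)))"
proof -
  define d where "d = z - (\<mu>1 + \<mu>2)"
  define L1 where "L1 = ggd_Lambda \<sigma>1 \<alpha>"
  define L2 where "L2 = ggd_Lambda \<sigma>2 \<beta>"
  define C where "C = complex_of_real (L1 / (2 * pi * Gamma (1 / \<alpha>)) * (L2 / (2 * pi * Gamma (1 / \<beta>))))"
  define J where "J = (\<integral>(t, v). G0_kernel \<alpha> \<beta> (1 / (L1 * d)\<^sup>2) (1 / (L2 * d)\<^sup>2) (Complex c1 t) (Complex c2 v) \<partial>lborel)"
  have L: "L1 > 0" "L2 > 0" using pos by (simp_all add: L1_def L2_def ggd_Lambda_pos)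
  have d: "d \<noteq> 0" using z by (simp add: d_def)
  have G: "Gamma (1 / \<alpha>) > 0" "Gamma (1 / \<beta>) > 0" using pos by (auto intro!: Gamma_real_pos)
  let ?f = "\<lambda>y. complex_of_real (ggd_density \<mu>1 \<sigma>1 \<alpha> (z - y) * ggd_density \<mu>2 \<sigma>2 \<beta> y)"
  have "has_bochner_integral lborel
     (\<lambda>x. C * (of_real (pi * \<alpha> * exp (- ((L1 * \<bar>d - x\<bar>) powr \<alpha>))) * of_real (pi * \<beta> * exp (- ((L2 * \<bar>x\<bar>) powr \<beta>)))))
     (C * (complex_of_real (sqrt pi / (L1 * L2 * \<bar>d\<bar>)) * J))"
    unfolding J_def using pos L d adm
    by (intro has_bochner_integral_mult_right has_bochner_integral_exp_powr_convolution)
  moreover have "C * (of_real (pi * \<alpha> * exp (- ((L1 * \<bar>d - x\<bar>) powr \<alpha>))) * of_real (pi * \<beta> * exp (- ((L2 * \<bar>x\<bar>) powr \<beta>)))) =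
     ?f (x + \<mu>2)" for x
  proof -
    have "\<bar>z - (x + \<mu>2) - \<mu>1\<bar> = \<bar>d - x\<bar>" by (simp add: d_def algebra_simps)
    thus ?thesis
      using pos by (simp add: ggd_density_eq C_def L1_def L2_def mult_ac)
  qed
  ultimately have "has_bochner_integral lborel (\<lambda>x. ?f (x + \<mu>2)) (C * (complex_of_real (sqrt pi / (L1 * L2 * \<bar>d\<bar>)) * J))"
    by simp
  hence hbi: "has_bochner_integral lborel ?f (C * (complex_of_real (sqrt pi / (L1 * L2 * \<bar>d\<bar>)) * J))"
    by (subst (asm) has_bochner_integral_lborel_shift)
  \<comment> \<open>The factor \<open>\<i> * \<i>\<close> from the two contour parametrizations
    cancels the sign of \<open>(2 * pi * \<i>)^2\<close>.\<close>
  have G0: "G0 \<alpha> \<beta> c1 c2 (1 / (L1 * d)\<^sup>2) (1 / (L2 * d)\<^sup>2) = of_real (1 / (2 * pi)\<^sup>2) * J"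
  proof -
    have "(\<integral>(t, v). G0_kernel \<alpha> \<beta> (1 / (L1 * d)\<^sup>2) (1 / (L2 * d)\<^sup>2) (Complex c1 t) (Complex c2 v) * \<i> * \<i> \<partial>lborel) = - J"
      by (simp add: J_def case_prod_unfold mult.assoc)
    thus ?thesis
      unfolding G0_def by (simp add: power_mult_distrib)
  qed
  have "C * (complex_of_real (sqrt pi / (L1 * L2 * \<bar>d\<bar>)) * J) =
     of_real (sqrt pi / (Gamma (1 / \<alpha>) * Gamma (1 / \<beta>) * \<bar>d\<bar>)) * (of_real (1 / (2 * pi)\<^sup>2) * J)"
  proof -
    have "L1 / (2 * pi * Gamma (1 / \<alpha>)) * (L2 / (2 * pi * Gamma (1 / \<beta>))) * (sqrt pi / (L1 * L2 * \<bar>d\<bar>)) =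
       sqrt pi / (Gamma (1 / \<alpha>) * Gamma (1 / \<beta>) * \<bar>d\<bar>) * (1 / (2 * pi)\<^sup>2)"
      using L by (simp add: power2_eq_square)
    thus ?thesis unfolding C_def by (simp only: flip: mult.assoc of_real_mult)
  qed
  with hbi G0 show ?thesis
    using pos unfolding d_def[symmetric] ggd_scale[OF pos(3,1)] ggd_scale[OF pos(4,2)]
    unfolding L1_def[symmetric] L2_def[symmetric] by simp
qed

theorem theorem3:
  fixes M :: "'a measure" and X Y :: "'a \<Rightarrow> real"
    and \<alpha> \<beta> \<mu>1 \<mu>2 \<sigma>1 \<sigma>2 :: real
  assumes "prob_space M"
    and "\<alpha> > 0" and "\<beta> > 0" and "\<sigma>1 > 0" and "\<sigma>2 > 0"
    and "distributed M lborel X (\<lambda>x. ennreal (ggd_density \<mu>1 \<sigma>1 \<alpha> x))"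
    and "distributed M lborel Y (\<lambda>y. ennreal (ggd_density \<mu>2 \<sigma>2 \<beta> y))"
    and "prob_space.indep_var M borel X borel Y"
  shows "\<exists>f :: real \<Rightarrow> real.
           distributed M lborel (\<lambda>\<omega>. X \<omega> + Y \<omega>) (\<lambda>z. ennreal (f z)) \<and>
           (\<forall>c1 c2. admissible_contour c1 c2 \<longrightarrow>
              (\<forall>z. z \<noteq> \<mu>1 + \<mu>2 \<longrightarrow>
                 complex_of_real (f z) =
                   complex_of_real (sqrt pi / (Gamma (1 / \<alpha>) * Gamma (1 / \<beta>) * \<bar>z - (\<mu>1 + \<mu>2)\<bar>))
                   * G0 \<alpha> \<beta> c1 c2
                       (\<sigma>1\<^sup>2 * Gamma (1 / \<alpha>) / (Gamma (3 / \<alpha>) * (z - (\<mu>1 + \<mu>2))\<^sup>2))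
                       (\<sigma>2\<^sup>2 * Gamma (1 / \<beta>) / (Gamma (3 / \<beta>) * (z - (\<mu>1 + \<mu>2))\<^sup>2))))"
proof -
  note pos = \<open>\<alpha> > 0\<close> \<open>\<beta> > 0\<close> \<open>\<sigma>1 > 0\<close> \<open>\<sigma>2 > 0\<close>
  let ?p = "\<lambda>z y. ggd_density \<mu>1 \<sigma>1 \<alpha> (z - y) * ggd_density \<mu>2 \<sigma>2 \<beta> y"
  \<comment> \<open>The convolution integral does not mention \<open>c1\<close> and
    \<open>c2\<close>, so one density serves all admissible contours.\<close>
  define f where "f z = (\<integral>y. ?p z y \<partial>lborel)" for z
  have "distributed M lborel (\<lambda>\<omega>. X \<omega> + Y \<omega>)
      (\<lambda>z. \<integral>\<^sup>+y. ennreal (ggd_density \<mu>1 \<sigma>1 \<alpha> (z - y)) * ennreal (ggd_density \<mu>2 \<sigma>2 \<beta> y) \<partial>lborel)"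
    using prob_space.distributed_convolution assms by blast
  moreover have "AE z in lborel.
      (\<integral>\<^sup>+y. ennreal (ggd_density \<mu>1 \<sigma>1 \<alpha> (z - y)) * ennreal (ggd_density \<mu>2 \<sigma>2 \<beta> y) \<partial>lborel) = ennreal (f z)"
    using AE_lborel_singleton[of "\<mu>1 + \<mu>2"]
  proof eventually_elim
    case (elim z)
    \<comment> \<open>Any admissible contour will do here: the aim is integrability of the
      convolution integrand, which turns the nonnegative integral into \<open>f z\<close>.\<close>
    have "admissible_contour (-1/8) (-1/8)" by (simp add: admissible_contour_def)
    from has_bochner_integral_ggd_convolution[OF pos this elim]
    have "integrable lborel (?p z)"
      unfolding has_bochner_integral_iff complex_of_real_integrable_eq ..
    thus ?case
      using pos by (simp add: f_def ggd_density_nonneg nn_integral_eq_integral flip: ennreal_mult)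
  qed
  ultimately have "distributed M lborel (\<lambda>\<omega>. X \<omega> + Y \<omega>) (\<lambda>z. ennreal (f z))"
    by (subst (asm) distributed_cong_density) (auto simp: f_def)
  moreover have "complex_of_real (f z) =
      complex_of_real (sqrt pi / (Gamma (1 / \<alpha>) * Gamma (1 / \<beta>) * \<bar>z - (\<mu>1 + \<mu>2)\<bar>))
        * G0 \<alpha> \<beta> c1 c2
            (\<sigma>1\<^sup>2 * Gamma (1 / \<alpha>) / (Gamma (3 / \<alpha>) * (z - (\<mu>1 + \<mu>2))\<^sup>2))
            (\<sigma>2\<^sup>2 * Gamma (1 / \<beta>) / (Gamma (3 / \<beta>) * (z - (\<mu>1 + \<mu>2))\<^sup>2))"
    if "admissible_contour c1 c2" "z \<noteq> \<mu>1 + \<mu>2" for c1 c2 z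
    using has_bochner_integral_integral_eq[OF has_bochner_integral_ggd_convolution[OF pos that]]
    unfolding integral_complex_of_real f_def .
  ultimately show ?thesis by blast
qed

end
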